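(* Let $(\mathcal{C},\mathcal{D})$ be a regular covering inclusion and $F$ a compatible cover for $\hat{\mathcal{D}}$. Then $\mathcal{E}_F^1(\mathcal{C},\mathcal{D})$ and $\mathfrak{R}_F(\mathcal{C},\mathcal{D})$ are locally compact Hausdorff topological groupoids and $\mathfrak{R}_F(\mathcal{C},\mathcal{D})$ is an étale groupoid. Their unit spaces are $\mathcal{E}_F^1(\mathcal{C},\mathcal{D})^{(0)}=\mathfrak{R}_F(\mathcal{C},\mathcal{D})^{(0)}=F$. Moreover, $\mathbb{T}\times F\overset{\iota}{\hookrightarrow}\mathcal{E}_F^1(\mathcal{C},\mathcal{D})\overset{\mathfrak{q}}{\twoheadrightarrow}\mathfrak{R}_F(\mathcal{C},\mathcal{D})$ is a locally trivial Hausdorff topological twist.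
   Context: All C*-algebras are unital; $(\mathcal{C},\mathcal{D})$ an inclusion ($\mathcal{D}$ abelian, containing the unit), $\mathcal{N}(\mathcal{C},\mathcal{D})=\{v: v^*\mathcal{D}v\cup v\mathcal{D}v^*\subseteq\mathcal{D}\}$ with dense span (regular). Compatible states: states $\rho$ on $\mathcal{C}$ with $|\rho(v)|^2\in\{0,\rho(v^*v)\}$ for all normalizers $v$; $\mathfrak{S}(\mathcal{C},\mathcal{D})$ their set. Covering inclusion: the restrictions to $\mathcal{D}$ of compatible states exhaust $\hat{\mathcal{D}}$. For a state $\rho$ with $\rho|_{\mathcal{D}}\in\hat{\mathcal{D}}$ and $\rho(v^*v)>0$, $\tilde\beta_v(\rho)(x)=\rho(v^*xv)/\rho(v^*v)$. A compatible cover is a weak-* closed $F\subseteq\mathfrak{S}(\mathcal{C},\mathcal{D})$ with $\tilde\beta_v(\rho)\in F$ whenever $\rho\in F$, $\rho(v^*v)>0$, and $\{\rho|_{\mathcal{D}}:\rho\in F\}=\hat{\mathcal{D}}$. For normalizer $v$ and $f\in F$ with $f(v^*v)\ne0$, $[v,f](x)=f(v^*x)/f(v^*v)^{1/2}$. $\mathcal{E}_F^1(\mathcal{C},\mathcal{D})=\{[v,f]\}$ with weak-* topology; source $[v,f]\mapsto f$, range $[v,f]\mapsto\tilde\beta_v(f)$; $(\phi_1,\phi_2)$ composable iff source of $\phi_1$ equals range of $\phi_2$, and then $[v_1,\tilde\beta_{v_2}(f)][v_2,f]=[v_1v_2,f]$ (well defined); inverse $\phi^{-1}(x)=\overline{\phi(x^*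 )}$; $F$ is identified with the units. $\mathfrak{R}_F(\mathcal{C},\mathcal{D})=\{|\phi|:\phi\in\mathcal{E}^1_F\}$ where $|\phi|(x)=|\phi(x)|$, $\mathfrak{q}(\phi)=|\phi|$, with the induced operations and the topology of pointwise convergence on $\mathcal{C}$; $\iota(z,f)=zf$. A twist is a sequence $\mathbb{T}\times G^{(0)}\overset{\iota}\hookrightarrow\Sigma\overset{\mathfrak{q}}\twoheadrightarrow G$ of locally compact groupoids with $G$ étale (the product groupoid $\mathbb{T}\times G^{(0)}$ having $(z_1,e)(z_2,e)=(z_1z_2,e)$ and product topology), where $\iota,\mathfrak{q}$ are continuous homomorphisms, $\iota$ injective, $\mathfrak{q}$ surjective, $\mathfrak{q}^{-1}(G^{(0)})=\iota(\mathbb{T}\times G^{(0)})$, $\iota|_{\{1\}\times G^{(0)}}$ and $\mathfrak{q}|_{\Sigma^{(0)}}$ are homeomorphisms onto $\Sigma^{(0)}$ and $G^{(0)}$, $\iota(z,r(\gamma))\gamma=\gamma\iota(z,s(\gamma))$, and each $g\in G$ has an open bisection neighbourhood $U$ with a continuous section $j_U:U\to\Sigma$ such that $(z,h)\mapsto\iota(z,r(h))j_U(h)$ is a homeomorphism $\mathbb{T}\times U\to\mathfrak{q}^{-1}(U)$ (local triviality). It is Hausdorff if $G$ is. *)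

theory Defs
  imports "HOL-Analysis.Analysis"
begin

class cstar_algebra = real_normed_algebra_1 + banach +
  fixes scaleC :: "complex \<Rightarrow> 'a \<Rightarrow> 'a"
    and adj :: "'a \<Rightarrow> 'a"
  assumes scaleC_of_real: "scaleC (complex_of_real r) x = scaleR r x"
    and scaleC_add_right: "scaleC c (x + y) = scaleC c x + scaleC c y"
    and scaleC_add_left: "scaleC (c + d) x = scaleC c x + scaleC d x"
    and scaleC_scaleC: "scaleC c (scaleC d x) = scaleC (c * d) x"
    and scaleC_one: "scaleC 1 x = x"
    and norm_scaleC: "norm (scaleC c x) = cmod c * norm x"
    and mult_scaleC_left: "scaleC c x * y = scaleC c (x * y)"
    and mult_scaleC_right: "x * scaleC c y = scaleC c (x * y)"
    and adj_adj: "adj (adj x) = x"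
    and adj_add: "adj (x + y) = adj x + adj y"
    and adj_mult: "adj (x * y) = adj y * adj x"
    and adj_scaleC: "adj (scaleC c x) = scaleC (cnj c) (adj x)"
    and cstar_identity: "norm (adj x * x) = norm x ^ 2"

text \<open>The ambient algebra C is the whole type; D is an abelian C*-subalgebra containing the unit.\<close>

definition abelian_cstar_subalgebra :: "'a::cstar_algebra set \<Rightarrow> bool" where
  "abelian_cstar_subalgebra D \<longleftrightarrow>
     1 \<in> D \<and> closed D \<and>
     (\<forall>x\<in>D. \<forall>y\<in>D. x + y \<in> D \<and> x * y \<in> D \<and> x * y = y * x) \<and>
     (\<forall>x\<in>D. \<forall>c. scaleC c x \<in> D) \<and> (\<forall>x\<in>D. adj x \<in> D)"

definition normalizers :: "'a::cstar_algebra set \<Rightarrow> 'a set" where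
  "normalizers D = {v. \<forall>d\<in>D. adj v * d * v \<in> D \<and> v * d * adj v \<in> D}"

definition complex_span :: "'a::cstar_algebra set \<Rightarrow> 'a set" where
  "complex_span S = {x. \<exists>(I::nat set) c v. finite I \<and> (\<forall>i\<in>I. v i \<in> S) \<and> x = (\<Sum>i\<in>I. scaleC (c i) (v i))}"

definition regular_inclusion :: "'a::cstar_algebra set \<Rightarrow> bool" where
  "regular_inclusion D \<longleftrightarrow> closure (complex_span (normalizers D)) = UNIV"

definition is_state :: "('a::cstar_algebra \<Rightarrow> complex) \<Rightarrow> bool" where
  "is_state \<rho> \<longleftrightarrow>
     (\<forall>x y. \<rho> (x + y) = \<rho> x + \<rho> y) \<and> (\<forall>c x. \<rho> (scaleC c x) = c * \<rho> x) \<and>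
     (\<forall>x. Im (\<rho> (adj x * x)) = 0 \<and> Re (\<rho> (adj x * x)) \<ge> 0) \<and>
     (\<forall>x. cmod (\<rho> x) \<le> norm x) \<and> \<rho> 1 = 1"

text \<open>Restriction to D (functionals on D are represented as functions vanishing off D).\<close>

definition restr :: "('a \<Rightarrow> complex) \<Rightarrow> 'a set \<Rightarrow> ('a \<Rightarrow> complex)" where
  "restr \<rho> D = (\<lambda>x. if x \<in> D then \<rho> x else 0)"

definition Dhat :: "'a::cstar_algebra set \<Rightarrow> ('a \<Rightarrow> complex) set" where
  "Dhat D = {ch. (\<forall>x. x \<notin> D \<longrightarrow> ch x = 0) \<and>
      (\<forall>x\<in>D. \<forall>y\<in>D. ch (x + y) = ch x + ch y \<and> ch (x * y) = ch x * ch y) \<and>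
      (\<forall>x\<in>D. \<forall>c. ch (scaleC c x) = c * ch x) \<and> (\<exists>x\<in>D. ch x \<noteq> 0)}"

definition compatible_states :: "'a::cstar_algebra set \<Rightarrow> ('a \<Rightarrow> complex) set" where
  "compatible_states D = {\<rho>. is_state \<rho> \<and>
      (\<forall>v\<in>normalizers D. complex_of_real ((cmod (\<rho> v))\<^sup>2) = 0 \<or>
                           complex_of_real ((cmod (\<rho> v))\<^sup>2) = \<rho> (adj v * v))}"

definition covering_inclusion :: "'a::cstar_algebra set \<Rightarrow> bool" where
  "covering_inclusion D \<longleftrightarrow> Dhat D \<subseteq> (\<lambda>\<rho>. restr \<rho> D) ` compatible_states D"

definition beta :: "'a::cstar_algebra \<Rightarrow> ('a \<Rightarrow> complex) \<Rightarrow> ('a \<Rightarrow> complex)" where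
  "beta v \<rho> = (\<lambda>x. \<rho> (adj v * x * v) / \<rho> (adj v * v))"

text \<open>Weak-* topology on states = topology of pointwise convergence = product topology
  on the function type.\<close>

definition compatible_cover :: "'a::cstar_algebra set \<Rightarrow> ('a \<Rightarrow> complex) set \<Rightarrow> bool" where
  "compatible_cover D F \<longleftrightarrow>
     F \<subseteq> compatible_states D \<and> closed F \<and>
     (\<forall>\<rho>\<in>F. \<forall>v\<in>normalizers D. Re (\<rho> (adj v * v)) > 0 \<longrightarrow> beta v \<rho> \<in> F) \<and>
     (\<lambda>\<rho>. restr \<rho> D) ` F = Dhat D"

definition bracket :: "'a::cstar_algebra \<Rightarrow> ('a \<Rightarrow> complex) \<Rightarrow> ('a \<Rightarrow> complex)" where
  "bracket v f = (\<lambda>x. f (adj v * x) / csqrt (f (adj v * v)))"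

definition E1 :: "'a::cstar_algebra set \<Rightarrow> ('a \<Rightarrow> complex) set \<Rightarrow> ('a \<Rightarrow> complex) set" where
  "E1 D F = {bracket v f | v f. v \<in> normalizers D \<and> f \<in> F \<and> f (adj v * v) \<noteq> 0}"

definition E_src :: "'a::cstar_algebra set \<Rightarrow> ('a \<Rightarrow> complex) set \<Rightarrow> ('a \<Rightarrow> complex) \<Rightarrow> ('a \<Rightarrow> complex)" where
  "E_src D F \<phi> = (SOME f. \<exists>v. v \<in> normalizers D \<and> f \<in> F \<and> f (adj v * v) \<noteq> 0 \<and> \<phi> = bracket v f)"

definition E_rng :: "'a::cstar_algebra set \<Rightarrow> ('a \<Rightarrow> complex) set \<Rightarrow> ('a \<Rightarrow> complex) \<Rightarrow> ('a \<Rightarrow> complex)" where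
  "E_rng D F \<phi> = (SOME g. \<exists>v f. v \<in> normalizers D \<and> f \<in> F \<and> f (adj v * v) \<noteq> 0 \<and>
                              \<phi> = bracket v f \<and> g = beta v f)"

definition E_mult :: "'a::cstar_algebra set \<Rightarrow> ('a \<Rightarrow> complex) set \<Rightarrow>
    ('a \<Rightarrow> complex) \<Rightarrow> ('a \<Rightarrow> complex) \<Rightarrow> ('a \<Rightarrow> complex)" where
  "E_mult D F \<phi>1 \<phi>2 = (SOME \<psi>. \<exists>v1 v2 f. v1 \<in> normalizers D \<and> v2 \<in> normalizers D \<and> f \<in> F \<and>
       f (adj v2 * v2) \<noteq> 0 \<and> beta v2 f (adj v1 * v1) \<noteq> 0 \<and>
       \<phi>2 = bracket v2 f \<and> \<phi>1 = bracket v1 (beta v2 f) \<and> \<psi> = bracket (v1 * v2) f)"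

definition E_inv :: "('a::cstar_algebra \<Rightarrow> complex) \<Rightarrow> ('a \<Rightarrow> complex)" where
  "E_inv \<phi> = (\<lambda>x. cnj (\<phi> (adj x)))"

definition absf :: "('a \<Rightarrow> complex) \<Rightarrow> ('a \<Rightarrow> real)" where
  "absf \<phi> = (\<lambda>x. cmod (\<phi> x))"

definition R :: "'a::cstar_algebra set \<Rightarrow> ('a \<Rightarrow> complex) set \<Rightarrow> ('a \<Rightarrow> real) set" where
  "R D F = absf ` E1 D F"

definition R_src :: "'a::cstar_algebra set \<Rightarrow> ('a \<Rightarrow> complex) set \<Rightarrow> ('a \<Rightarrow> real) \<Rightarrow> ('a \<Rightarrow> real)" where
  "R_src D F r = (SOME \<sigma>. \<exists>\<phi>\<in>E1 D F. r = absf \<phi> \<and> \<sigma> = absf (E_src D F \<phi>))"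

definition R_rng :: "'a::cstar_algebra set \<Rightarrow> ('a \<Rightarrow> complex) set \<Rightarrow> ('a \<Rightarrow> real) \<Rightarrow> ('a \<Rightarrow> real)" where
  "R_rng D F r = (SOME \<sigma>. \<exists>\<phi>\<in>E1 D F. r = absf \<phi> \<and> \<sigma> = absf (E_rng D F \<phi>))"

definition R_mult :: "'a::cstar_algebra set \<Rightarrow> ('a \<Rightarrow> complex) set \<Rightarrow>
    ('a \<Rightarrow> real) \<Rightarrow> ('a \<Rightarrow> real) \<Rightarrow> ('a \<Rightarrow> real)" where
  "R_mult D F r1 r2 = (SOME \<sigma>. \<exists>\<phi>1\<in>E1 D F. \<exists>\<phi>2\<in>E1 D F. E_src D F \<phi>1 = E_rng D F \<phi>2 \<and>
       r1 = absf \<phi>1 \<and> r2 = absf \<phi>2 \<and> \<sigma> = absf (E_mult D F \<phi>1 \<phi>2))"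

definition R_inv :: "('a::cstar_algebra \<Rightarrow> real) \<Rightarrow> ('a \<Rightarrow> real)" where
  "R_inv r = (\<lambda>x. r (adj x))"

definition iota :: "complex \<times> ('a \<Rightarrow> complex) \<Rightarrow> ('a \<Rightarrow> complex)" where
  "iota p = (\<lambda>x. fst p * snd p x)"

definition groupoid :: "'g set \<Rightarrow> 'g set \<Rightarrow> ('g \<Rightarrow> 'g) \<Rightarrow> ('g \<Rightarrow> 'g) \<Rightarrow>
    ('g \<Rightarrow> 'g \<Rightarrow> 'g) \<Rightarrow> ('g \<Rightarrow> 'g) \<Rightarrow> bool" where
  "groupoid G G0 s r m i \<longleftrightarrow>
     G0 \<subseteq> G \<and> (\<forall>x\<in>G. s x \<in> G0 \<and> r x \<in> G0) \<and> (\<forall>u\<in>G0. s u = u \<and> r u = u) \<and>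
     (\<forall>x\<in>G. \<forall>y\<in>G. s x = r y \<longrightarrow> m x y \<in> G \<and> s (m x y) = s y \<and> r (m x y) = r x) \<and>
     (\<forall>x\<in>G. \<forall>y\<in>G. \<forall>z\<in>G. s x = r y \<and> s y = r z \<longrightarrow> m (m x y) z = m x (m y z)) \<and>
     (\<forall>x\<in>G. m (r x) x = x \<and> m x (s x) = x) \<and>
     (\<forall>x\<in>G. i x \<in> G \<and> s (i x) = r x \<and> r (i x) = s x \<and> m (i x) x = s x \<and> m x (i x) = r x)"

definition composable :: "'g set \<Rightarrow> ('g \<Rightarrow> 'g) \<Rightarrow> ('g \<Rightarrow> 'g) \<Rightarrow> ('g \<times> 'g) set" where
  "composable G s r = {(x, y). x \<in> G \<and> y \<in> G \<and> s x = r y}"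

definition topological_groupoid :: "'g::topological_space set \<Rightarrow> 'g set \<Rightarrow> ('g \<Rightarrow> 'g) \<Rightarrow>
    ('g \<Rightarrow> 'g) \<Rightarrow> ('g \<Rightarrow> 'g \<Rightarrow> 'g) \<Rightarrow> ('g \<Rightarrow> 'g) \<Rightarrow> bool" where
  "topological_groupoid G G0 s r m i \<longleftrightarrow>
     groupoid G G0 s r m i \<and> continuous_on G s \<and> continuous_on G r \<and> continuous_on G i \<and>
     continuous_on (composable G s r) (\<lambda>(x, y). m x y)"

definition lc_groupoid where
  "lc_groupoid G G0 s r m i \<longleftrightarrow>
     topological_groupoid G G0 s r m i \<and> locally_compact_space (top_of_set G)"

definition lch_groupoid where
  "lch_groupoid G G0 s r m i \<longleftrightarrow>
     lc_groupoid G G0 s r m i \<and> Hausdorff_space (top_of_set G)"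

definition etale_groupoid where
  "etale_groupoid G G0 s r m i \<longleftrightarrow>
     topological_groupoid G G0 s r m i \<and>
     (\<forall>x\<in>G. \<exists>U. openin (top_of_set G) U \<and> x \<in> U \<and> openin (top_of_set G) (r ` U) \<and>
                 (\<exists>g. homeomorphism U (r ` U) r g))"

definition open_bisection :: "'g::topological_space set \<Rightarrow> ('g \<Rightarrow> 'g) \<Rightarrow> ('g \<Rightarrow> 'g) \<Rightarrow> 'g set \<Rightarrow> bool" where
  "open_bisection G s r U \<longleftrightarrow> openin (top_of_set G) U \<and> inj_on s U \<and> inj_on r U"

definition circle :: "complex set" where
  "circle = sphere 0 1"

text \<open>A (locally trivial) twist; following the paper's statement, iota is defined on
  T x Sigma^(0) (the unit space of Sigma), which q identifies with G^(0).\<close>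

definition twist :: "'s::topological_space set \<Rightarrow> 's set \<Rightarrow> ('s \<Rightarrow> 's) \<Rightarrow> ('s \<Rightarrow> 's) \<Rightarrow>
    ('s \<Rightarrow> 's \<Rightarrow> 's) \<Rightarrow> ('s \<Rightarrow> 's) \<Rightarrow>
    'g::topological_space set \<Rightarrow> 'g set \<Rightarrow> ('g \<Rightarrow> 'g) \<Rightarrow> ('g \<Rightarrow> 'g) \<Rightarrow>
    ('g \<Rightarrow> 'g \<Rightarrow> 'g) \<Rightarrow> ('g \<Rightarrow> 'g) \<Rightarrow>
    (complex \<times> 's \<Rightarrow> 's) \<Rightarrow> ('s \<Rightarrow> 'g) \<Rightarrow> bool" where
  "twist S S0 sS rS mS iS G G0 sG rG mG iG \<iota> q \<longleftrightarrow>
     lc_groupoid S S0 sS rS mS iS \<and> lc_groupoid G G0 sG rG mG iG \<and>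
     etale_groupoid G G0 sG rG mG iG \<and>
     \<iota> ` (circle \<times> S0) \<subseteq> S \<and> continuous_on (circle \<times> S0) \<iota> \<and>
     (\<forall>z1\<in>circle. \<forall>z2\<in>circle. \<forall>e\<in>S0.
         sS (\<iota> (z1, e)) = rS (\<iota> (z2, e)) \<and> mS (\<iota> (z1, e)) (\<iota> (z2, e)) = \<iota> (z1 * z2, e)) \<and>
     q ` S \<subseteq> G \<and> continuous_on S q \<and>
     (\<forall>x\<in>S. \<forall>y\<in>S. sS x = rS y \<longrightarrow> sG (q x) = rG (q y) \<and> q (mS x y) = mG (q x) (q y)) \<and>
     inj_on \<iota> (circle \<times> S0) \<and> q ` S = G \<and>
     {x\<in>S. q x \<in> G0} = \<iota> ` (circle \<times> S0) \<and>
     (\<exists>g. homeomorphism ({1} \<times> S0) S0 \<iota> g) \<and>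
     (\<exists>g. homeomorphism S0 G0 q g) \<and>
     (\<forall>\<gamma>\<in>S. \<forall>z\<in>circle. mS (\<iota> (z, rS \<gamma>)) \<gamma> = mS \<gamma> (\<iota> (z, sS \<gamma>))) \<and>
     (\<forall>g\<in>G. \<exists>U j. open_bisection G sG rG U \<and> g \<in> U \<and>
        continuous_on U j \<and> j ` U \<subseteq> S \<and> (\<forall>h\<in>U. q (j h) = h) \<and>
        (\<exists>k. homeomorphism (circle \<times> U) {x\<in>S. q x \<in> U}
               (\<lambda>(z, h). mS (\<iota> (z, rS (j h))) (j h)) k))"

end

theory Submission
  imports Defs
begin

text \<open>Let \<open>f\<close> be in the cover and \<open>u\<close> a normalizer with \<open>f u \<noteq> 0\<close>. Compatibility for \<open>u\<close> and \<open>adj u\<close>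
  puts \<open>u\<close> into the multiplicative domain of \<open>f\<close>, so \<open>f (u * x) = f u * f x = f (x * u)\<close>. Hence for
  \<open>\<phi> = [v, f]\<close> with range \<open>g\<close> and every normalizer \<open>w\<close> with \<open>\<phi> w \<noteq> 0\<close> one has
  \<open>\<phi> (w * x) = \<phi> w * f x\<close>, \<open>\<phi> (x * w) = g x * \<phi> w\<close> and \<open>\<phi> x * cnj (\<phi> w) = f (adj w * x) = g (x * adj w)\<close>;
  moreover \<open>(\<phi> \<psi>) x = \<psi> (adj w * x) / cnj (\<phi> w)\<close>. These formulas show that the structure maps are well
  defined, and on the open set \<open>\<phi> w \<noteq> 0\<close> they exhibit them as continuous for pointwise convergence.
  They also give \<open>\<phi> = z [w, f]\<close> with \<open>z\<close> on the circle, which yields local compactness (from compactness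
  of the cover), the fact that \<open>h w \<noteq> 0\<close> defines an open bisection in \<open>R\<close>, and the local
  trivialization. Finally, a state is determined continuously by its absolute value, so passing from \<open>\<phi>\<close>
  to \<open>|\<phi>|\<close> only forgets the phase \<open>z\<close>.\<close>

section \<open>Topology of pointwise convergence\<close>

text \<open>Continuity is local. The structure maps have explicit formulas only where evaluation at
  some normalizer is nonzero, and that open set varies with the point.\<close>

lemma continuous_on_if_locally_open:
  assumes "\<And>x. x \<in> S \<Longrightarrow> \<exists>U. open U \<and> x \<in> U \<and> continuous_on (S \<inter> U) f"
  shows "continuous_on S f"
  unfolding continuous_on_def
proof
  fix x assume "x \<in> S"
  then obtain U where U: "open U" "x \<in> U" "continuous_on (S \<inter> U) f"
    using assms by blast
  have "at x within S \<inter> U = at x within S"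
    using U(1,2) by (intro at_within_nhd[of x U]) auto
  then show "(f \<longlongrightarrow> f x) (at x within S)"
    using U(2,3) \<open>x \<in> S\<close> by (metis IntI continuous_on_def)
qed

lemma continuous_on_eval: "continuous_on S (\<lambda>h. h x)"
  by (rule continuous_on_subset[OF continuous_on_product_coordinates]) simp

lemma continuous_on_fst_eval: "continuous_on S (\<lambda>p. fst p x)"
  by (rule continuous_on_product_then_coordinatewise[OF continuous_on_fst[OF continuous_on_id]])

lemma continuous_on_snd_eval: "continuous_on S (\<lambda>p. snd p x)"
  by (rule continuous_on_product_then_coordinatewise[OF continuous_on_snd[OF continuous_on_id]])

lemma open_eval_nonzero: "open {h :: 'a \<Rightarrow> 'b::real_normed_vector. h x \<noteq> 0}"
  by (intro open_Collect_neq continuous_on_eval continuous_on_const)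

lemma Hausdorff_space_fun: "Hausdorff_space (top_of_set (S :: ('a \<Rightarrow> 'b::metric_space) set))"
proof (rule Hausdorff_space_subtopology)
  have "Hausdorff_space (product_topology (\<lambda>_. euclidean :: 'b topology) (UNIV :: 'a set))"
    unfolding Hausdorff_space_product_topology by simp
  then show "Hausdorff_space (euclidean :: ('a \<Rightarrow> 'b) topology)"
    by (simp add: euclidean_product_topology)
qed

lemma locally_compact_space_top_of_set:
  assumes "\<And>x. x \<in> S \<Longrightarrow> \<exists>U K. open U \<and> compact K \<and> K \<subseteq> S \<and> x \<in> U \<and> S \<inter> U \<subseteq> K"
  shows "locally_compact_space (top_of_set S)"
  unfolding locally_compact_space_def
proof
  fix x assume "x \<in> topspace (top_of_set S)"
  then obtain U K where "open U" "compact K" "K \<subseteq> S" "x \<in> U" "S \<inter> U \<subseteq> K" "x \<in> S"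
    using assms[of x] by auto
  then show "\<exists>U K. openin (top_of_set S) U \<and> compactin (top_of_set S) K \<and> x \<in> U \<and> U \<subseteq> K"
    by (intro exI[of _ "S \<inter> U"] exI[of _ K]) (auto simp: compactin_subtopology openin_open_Int)
qed

text \<open>Tychonoff: the set is a product of closed balls. For functionals bounded by the norm
  this is the Banach-Alaoglu argument.\<close>

lemma compact_fun_cball:
  "compact {h :: 'a \<Rightarrow> 'b::euclidean_space. \<forall>x. norm (h x) \<le> B x}"
proof -
  have "compactin (product_topology (\<lambda>_. euclidean) UNIV) (PiE UNIV (\<lambda>x. cball (0::'b) (B x)))"
    by (simp add: compactin_PiE)
  moreover have "PiE UNIV (\<lambda>x. cball (0::'b) (B x)) = {h. \<forall>x. norm (h x) \<le> B x}"
    by auto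
  ultimately show ?thesis
    by (simp add: euclidean_product_topology)
qed

section \<open>States\<close>

lemma adj_one [simp]: "adj (1::'a::cstar_algebra) = 1"
  by (metis adj_adj adj_mult mult.left_neutral)

lemma scaleC_zero_left [simp]: "scaleC 0 (x::'a::cstar_algebra) = 0"
  by (metis of_real_0 scaleC_of_real scaleR_zero_left)

lemma scaleC_minus_one: "scaleC (-1) (x::'a::cstar_algebra) = - x"
  by (metis of_real_1 of_real_minus scaleC_of_real scaleR_minus1_left)

lemma adj_diff: "adj (x - y) = adj x - adj (y::'a::cstar_algebra)"
  by (metis adj_add add_diff_cancel_right' diff_add_cancel)

lemma is_state_simps:
  assumes "is_state f"
  shows "f (x + y) = f x + f y" "f (scaleC c x) = c * f x" "f 0 = 0" "f (- x) = - f x"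
    "f (x - y) = f x - f y" "f 1 = 1"
proof -
  show add: "f (x + y) = f x + f y" for x y
    using assms by (auto simp: is_state_def)
  show scl: "f (scaleC c x) = c * f x" for c x
    using assms by (auto simp: is_state_def)
  show "f 1 = 1"
    using assms by (auto simp: is_state_def)
  show "f 0 = 0"
    using scl[of 0 0] by simp
  show min: "f (- x) = - f x" for x
    using scl[of "-1" x] by (simp add: scaleC_minus_one)
  show "f (x - y) = f x - f y"
    using add[of x "- y"] min[of y] by simp
qed

lemma state_adj:
  assumes "is_state f"
  shows "f (adj x) = cnj (f x)"
proof -
  note s = is_state_simps[OF assms]
  have real: "Im (f (adj y * y)) = 0" for y
    using assms by (auto simp: is_state_def)
  \<comment> \<open>Expanding the real values at \<open>x + 1\<close> and
    \<open>x + scaleC \<i> 1\<close> isolates \<open>f (adj x) + f x\<close> and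
    \<open>\<i> * (f (adj x) - f x)\<close>, up to real terms.\<close>
  have "Im (f (adj x)) = - Im (f x)"
    using real[of "x + 1"] real[of x] by (simp add: adj_add algebra_simps s)
  moreover have "Re (f (adj x)) = Re (f x)"
    using real[of "x + scaleC \<i> 1"] real[of x]
    by (simp add: adj_add adj_scaleC algebra_simps s mult_scaleC_left mult_scaleC_right)
  ultimately show ?thesis
    by (simp add: complex_eq_iff)
qed

text \<open>The degenerate case of Cauchy-Schwarz: if the cross term survived, a large multiple of
  \<open>a\<close> added to \<open>y\<close> would make a positive value negative.\<close>

lemma state_null_left:
  assumes f: "is_state f" and null: "f (adj a * a) = 0"
  shows "f (adj a * y) = 0"
proof (rule ccontr)
  assume "f (adj a * y) \<noteq> 0"
  note s = is_state_simps[OF f]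
  define z where "z = f (adj a * y)"
  define b where "b = Re (f (adj y * y))"
  \<comment> \<open>The value that makes \<open>b + 2 * t * (cmod z)\<^sup>2\<close> equal to
    \<open>-1\<close>.\<close>
  define t where "t = - (b + 1) / (2 * (cmod z)\<^sup>2)"
  define c where "c = of_real t * z"
  have z: "(cmod z)\<^sup>2 > 0"
    using \<open>f (adj a * y) \<noteq> 0\<close> by (simp add: z_def)
  have zc: "f (adj y * a) = cnj z"
    using state_adj[OF f, of "adj a * y"] by (simp add: adj_mult adj_adj z_def)
  have "f (adj (y + scaleC c a) * (y + scaleC c a))
      = f (adj y * y) + cnj c * z + c * cnj z + cnj c * (c * f (adj a * a))"
    by (simp add: adj_add adj_scaleC algebra_simps s mult_scaleC_left mult_scaleC_right z_def[symmetric] zc)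
  then have "Re (f (adj (y + scaleC c a) * (y + scaleC c a))) = b + 2 * t * (cmod z)\<^sup>2"
    unfolding null by (simp only: b_def c_def cmod_power2) (simp add: power2_eq_square algebra_simps)
  also have "\<dots> = -1"
    using z by (simp add: t_def field_simps)
  finally show False
    using f unfolding is_state_def by (metis neg_0_le_iff_le not_one_le_zero)
qed

text \<open>The hypothesis says that \<open>u\<close> has no variance under \<open>f\<close>, so the
  deviation of \<open>u\<close> from the scalar \<open>f u\<close> is a null vector and drops out of
  every product.\<close>

lemma state_mult_left:
  assumes f: "is_state f" and u: "f (u * adj u) = f u * cnj (f u)"
  shows "f (u * x) = f u * f x"
proof -
  note s = is_state_simps[OF f]
  define a where "a = adj u - scaleC (cnj (f u)) 1"
  have a: "adj a = u - scaleC (f u) 1"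
    by (simp add: a_def adj_diff adj_adj adj_scaleC)
  have "f (adj a * a) = 0"
    unfolding a
    by (simp add: a_def algebra_simps s mult_scaleC_left mult_scaleC_right u state_adj[OF f])
  then have "f (adj a * x) = 0"
    by (rule state_null_left[OF f])
  then show ?thesis
    unfolding a by (simp add: algebra_simps s mult_scaleC_left)
qed

lemma state_mult_right:
  assumes f: "is_state f" and u: "f (adj u * u) = f u * cnj (f u)"
  shows "f (x * u) = f x * f u"
proof -
  have "f (adj u * adj x) = f (adj u) * f (adj x)"
    using state_mult_left[OF f, of "adj u" "adj x"] u
    by (simp add: adj_adj state_adj[OF f] mult.commute)
  then have "cnj (f (x * u)) = cnj (f u) * cnj (f x)"
    by (metis adj_mult f state_adj)
  then show ?thesis
    by (metis complex_cnj_cnj complex_cnj_mult mult.commute)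
qed

lemma state_norm_nonneg:
  assumes "is_state f"
  shows "f (adj v * v) = of_real (Re (f (adj v * v)))" "0 \<le> Re (f (adj v * v))"
  using assms by (auto simp: is_state_def complex_eq_iff)

lemma normalizers_adj: "v \<in> normalizers D \<Longrightarrow> adj v \<in> normalizers D"
  by (simp add: normalizers_def adj_adj)

lemma normalizers_mult:
  assumes "v \<in> normalizers D" "w \<in> normalizers D"
  shows "v * w \<in> normalizers D"
proof -
  have "adj w * (adj v * d * v) * w \<in> D" "v * (w * d * adj w) * adj v \<in> D" if "d \<in> D" for d
    using assms that by (auto simp: normalizers_def)
  then show ?thesis
    by (simp add: normalizers_def adj_mult mult.assoc)
qed

section \<open>Compatible covers\<close>

locale cover_inclusion =
  fixes D :: "'a::cstar_algebra set" and F :: "('a \<Rightarrow> complex) set"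
  assumes abelian: "abelian_cstar_subalgebra D" and cover: "compatible_cover D F"
begin

abbreviation "N \<equiv> normalizers D"

lemma D_one: "1 \<in> D" and D_mult: "x \<in> D \<Longrightarrow> y \<in> D \<Longrightarrow> x * y \<in> D"
  and D_scaleC: "x \<in> D \<Longrightarrow> scaleC c x \<in> D" and D_adj: "x \<in> D \<Longrightarrow> adj x \<in> D"
  and D_commute: "x \<in> D \<Longrightarrow> y \<in> D \<Longrightarrow> x * y = y * x"
  using abelian by (auto simp: abelian_cstar_subalgebra_def)

lemma N_one: "1 \<in> N"
  by (simp add: normalizers_def)

lemma N_scaleC: "v \<in> N \<Longrightarrow> scaleC c v \<in> N"
  by (simp add: normalizers_def adj_scaleC mult_scaleC_left mult_scaleC_right D_scaleC)

lemma N_conj: "v \<in> N \<Longrightarrow> d \<in> D \<Longrightarrow> adj v * d * v \<in> D"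
  by (simp add: normalizers_def)

lemma N_norm: "v \<in> N \<Longrightarrow> adj v * v \<in> D" "v \<in> N \<Longrightarrow> v * adj v \<in> D"
  using N_conj[OF _ D_one, of v] N_conj[OF normalizers_adj D_one, of v] by (simp_all add: adj_adj)

lemma F_state: "f \<in> F \<Longrightarrow> is_state f"
  using cover unfolding compatible_cover_def compatible_states_def by blast

lemma F_compatible:
  assumes "f \<in> F" "v \<in> N" "f v \<noteq> 0"
  shows "f (adj v * v) = f v * cnj (f v)"
proof -
  have "f \<in> compatible_states D"
    using cover assms(1) unfolding compatible_cover_def by blast
  then show ?thesis
    using assms(2,3) unfolding compatible_states_def complex_norm_square[symmetric] by auto
qed

lemma F_mult_D: "f \<in> F \<Longrightarrow> x \<in> D \<Longrightarrow> y \<in> D \<Longrightarrow> f (x * y) = f x * f y"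
proof -
  assume "f \<in> F" "x \<in> D" "y \<in> D"
  then have "restr f D \<in> Dhat D"
    using cover unfolding compatible_cover_def by blast
  with \<open>x \<in> D\<close> \<open>y \<in> D\<close> show ?thesis
    using D_mult[of x y] unfolding Dhat_def restr_def by (simp split: if_splits)
qed

text \<open>Elements of \<open>D\<close> lie in the multiplicative domain of \<open>f\<close>, since
  \<open>f\<close> restricts to a character of \<open>D\<close>.\<close>

lemma F_D_left: "f \<in> F \<Longrightarrow> d \<in> D \<Longrightarrow> f (d * x) = f d * f x"
  by (rule state_mult_left[OF F_state]) (metis F_mult_D D_adj F_state state_adj)+

lemma F_D_right: "f \<in> F \<Longrightarrow> d \<in> D \<Longrightarrow> f (x * d) = f x * f d"
  by (rule state_mult_right[OF F_state]) (metis F_mult_D D_adj F_state state_adj mult.commute)+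

lemma F_N_left:
  assumes "f \<in> F" "u \<in> N" "f u \<noteq> 0"
  shows "f (u * x) = f u * f x"
proof (rule state_mult_left)
  \<comment> \<open>Compatibility is applied to \<open>adj u\<close>, whose value is the conjugate
    of \<open>f u\<close> and hence also nonzero.\<close>
  show "f (u * adj u) = f u * cnj (f u)"
    using F_compatible[OF assms(1) normalizers_adj[OF assms(2)]] assms(3)
    by (simp add: state_adj[OF F_state[OF assms(1)]] adj_adj mult.commute)
qed (simp add: F_state assms)

lemma F_N_right:
  assumes "f \<in> F" "u \<in> N" "f u \<noteq> 0"
  shows "f (x * u) = f x * f u"
  by (rule state_mult_right[OF F_state[OF assms(1)] F_compatible[OF assms]])

lemma F_beta:
  assumes "f \<in> F" "v \<in> N" "f (adj v * v) \<noteq> 0"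
  shows "beta v f \<in> F"
proof -
  have "Re (f (adj v * v)) > 0"
    using state_norm_nonneg[OF F_state[OF assms(1)], of v] assms(3)
    by (metis less_eq_real_def of_real_0)
  then show ?thesis
    using cover assms unfolding compatible_cover_def by blast
qed

subsection \<open>Normalized representatives\<close>

text \<open>Normalizing \<open>v\<close> so that \<open>f (adj v * v) = 1\<close> removes the square roots from \<open>bracket\<close>.\<close>

definition rep :: "'a \<Rightarrow> ('a \<Rightarrow> complex) \<Rightarrow> ('a \<Rightarrow> complex) \<Rightarrow> bool" where
  "rep v f \<phi> \<longleftrightarrow> v \<in> N \<and> f \<in> F \<and> f (adj v * v) = 1 \<and> \<phi> = (\<lambda>x. f (adj v * x))"

lemma rep_bracket: "rep v f \<phi> \<Longrightarrow> \<phi> = bracket v f"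
  by (auto simp: rep_def bracket_def)

lemma rep_beta: "rep v f \<phi> \<Longrightarrow> beta v f = (\<lambda>x. f (adj v * x * v))"
  by (auto simp: rep_def beta_def)

lemma rep_in: "rep v f \<phi> \<Longrightarrow> f \<in> F" "rep v f \<phi> \<Longrightarrow> beta v f \<in> F" "rep v f \<phi> \<Longrightarrow> v \<in> N"
  using F_beta[of f v] by (simp_all add: rep_def)

text \<open>Rescaling \<open>v\<close> by a positive number changes neither the bracket nor
  \<open>beta\<close>, so \<open>v\<close> can be divided by the square root of
  \<open>f (adj v * v)\<close>.\<close>

lemma bracket_normalize:
  assumes "v \<in> N" "f \<in> F" "f (adj v * v) \<noteq> 0"
  obtains c :: real where "c > 0" "rep (scaleC c v) f (bracket v f)"
    "beta (scaleC c v) f = beta v f"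
proof -
  define t where "t = Re (f (adj v * v))"
  note st = state_norm_nonneg[OF F_state[OF assms(2)], of v, folded t_def]
  have t: "f (adj v * v) = of_real t" "t > 0"
    using st assms(3) by (auto simp: less_le)
  define c where "c = 1 / sqrt t"
  have c: "c > 0" "c * c * t = 1"
    using t by (auto simp: c_def)
  note s = is_state_simps[OF F_state[OF assms(2)]]
  have norm: "f (adj (scaleC c v) * scaleC c v) = 1"
    using c(2) t(1)
    by (simp add: adj_scaleC mult_scaleC_left mult_scaleC_right s mult.assoc flip: of_real_mult)
  show thesis
  proof
    show "rep (scaleC c v) f (bracket v f)"
      using assms norm t
      by (auto simp: rep_def N_scaleC bracket_def adj_scaleC mult_scaleC_left s c_def)
    show "beta (scaleC c v) f = beta v f"
      using c(1) assms(3) by (auto simp: beta_def adj_scaleC mult_scaleC_left mult_scaleC_right s)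
  qed (rule c)
qed

lemma E1_rep: "\<phi> \<in> E1 D F \<longleftrightarrow> (\<exists>v f. rep v f \<phi>)"
proof
  assume "\<phi> \<in> E1 D F"
  then obtain v f where "v \<in> N" "f \<in> F" "f (adj v * v) \<noteq> 0" "\<phi> = bracket v f"
    unfolding E1_def by blast
  then show "\<exists>v f. rep v f \<phi>"
    by (metis bracket_normalize)
next
  assume "\<exists>v f. rep v f \<phi>"
  then obtain v f where r: "rep v f \<phi>"
    by blast
  then show "\<phi> \<in> E1 D F"
    using rep_bracket[OF r] unfolding E1_def rep_def by force
qed

lemma rep_unit: "f \<in> F \<Longrightarrow> rep 1 f f" "f \<in> F \<Longrightarrow> beta 1 f = f"
  using is_state_simps(6)[OF F_state, of f] by (simp_all add: rep_def beta_def N_one)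

lemma rep_self: "rep v f \<phi> \<Longrightarrow> \<phi> v = 1"
  by (auto simp: rep_def)

text \<open>This lets any normalizer \<open>w\<close> with \<open>\<phi> w \<noteq> 0\<close>
  replace the representing \<open>v\<close>, up to the scalar \<open>cnj (\<phi> w)\<close>.\<close>

lemma rep_cnj_source:
  assumes r: "rep v f \<phi>" and w: "w \<in> N" "\<phi> w \<noteq> 0"
  shows "f (adj w * x) = \<phi> x * cnj (\<phi> w)"
proof -
  have v: "v \<in> N" "f \<in> F" "f (adj v * v) = 1" "\<phi> = (\<lambda>x. f (adj v * x))"
    using r by (auto simp: rep_def)
  have wv: "f (adj w * v) = cnj (\<phi> w)"
    using state_adj[OF F_state[OF v(2)], of "adj v * w"] v(4) by (simp add: adj_mult adj_adj)
  have u: "f (adj w * v * y) = cnj (\<phi> w) * f y" for y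
    using F_N_left[OF v(2) normalizers_mult[OF normalizers_adj[OF w(1)] v(1)]] wv w(2) by simp
  \<comment> \<open>The two sides come from one product in which \<open>w * adj w\<close> and
    \<open>v * adj v\<close> are interchanged inside \<open>D\<close>; a left factor in
    \<open>D\<close> is then split off from each form.\<close>
  have eq: "f (adj w * w) * (cnj (\<phi> w) * \<phi> y) = f (adj w * (v * adj v) * w) * f (adj w * y)" for y
  proof -
    have "f (adj w * w) * (cnj (\<phi> w) * \<phi> y) = f (adj w * w) * f (adj w * v * (adj v * y))"
      by (simp only: u v(4))
    also have "\<dots> = f (adj w * w * (adj w * v * (adj v * y)))"
      by (simp only: F_D_left[OF v(2) N_norm(1)[OF w(1)]])
    also have "adj w * w * (adj w * v * (adj v * y)) = adj w * ((w * adj w) * (v * adj v)) * y"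
      by (simp only: mult.assoc)
    also have "\<dots> = adj w * ((v * adj v) * (w * adj w)) * y"
      using D_commute[OF N_norm(2)[OF v(1)] N_norm(2)[OF w(1)]] by simp
    also have "\<dots> = (adj w * (v * adj v) * w) * (adj w * y)"
      by (simp only: mult.assoc)
    also have "f \<dots> = f (adj w * (v * adj v) * w) * f (adj w * y)"
      by (rule F_D_left[OF v(2) N_conj[OF w(1) N_norm(2)[OF v(1)]]])
    finally show ?thesis .
  qed
  \<comment> \<open>At \<open>y = v\<close> the cross factors cancel, so the two coefficients in
    \<open>eq\<close> agree. The next step shows that they are nonzero, so they cancel as
    well.\<close>
  have "f (adj w * w) = f (adj w * (v * adj v) * w)"
    using eq[of v] w(2) by (simp add: rep_self[OF r] wv)
  moreover have "f (adj w * (v * adj v) * w) = cnj (\<phi> w) * \<phi> w"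
    using u[of "adj v * w"] v(4) by (simp add: mult.assoc)
  ultimately show ?thesis
    using eq[of x] w(2) by (simp add: mult.commute)
qed

text \<open>The normalizer \<open>adj w * v\<close> has the nonzero value
  \<open>cnj (\<phi> w)\<close> under \<open>f\<close>, so it splits off on the right.\<close>

lemma rep_cnj_range:
  assumes r: "rep v f \<phi>" and w: "w \<in> N" "\<phi> w \<noteq> 0"
  shows "beta v f (x * adj w) = \<phi> x * cnj (\<phi> w)"
proof -
  have v: "v \<in> N" "f \<in> F" "\<phi> = (\<lambda>x. f (adj v * x))"
    using r by (auto simp: rep_def)
  have wv: "f (adj w * v) = cnj (\<phi> w)"
    using state_adj[OF F_state[OF v(2)], of "adj v * w"] v(3) by (simp add: adj_mult adj_adj)
  have "f (adj v * x * (adj w * v)) = f (adj v * x) * f (adj w * v)"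
    using F_N_right[OF v(2) normalizers_mult[OF normalizers_adj[OF w(1)] v(1)]] wv w(2) by simp
  then show ?thesis
    by (simp add: rep_beta[OF r] wv v(3) mult.assoc)
qed

lemma rep_mult_source:
  assumes r: "rep v f \<phi>" and w: "w \<in> N" "\<phi> w \<noteq> 0"
  shows "\<phi> (w * x) = \<phi> w * f x"
proof -
  have v: "v \<in> N" "f \<in> F" "\<phi> = (\<lambda>x. f (adj v * x))"
    using r by (auto simp: rep_def)
  show ?thesis
    using F_N_left[OF v(2) normalizers_mult[OF normalizers_adj[OF v(1)] w(1)], of x] w(2) v(3)
    by (simp add: mult.assoc)
qed

text \<open>Multiplying by \<open>cnj (\<phi> w)\<close> turns the left side into a value of
  \<open>beta v f\<close>, where \<open>w * adj w\<close> in \<open>D\<close> splits off.\<close>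

lemma rep_mult_range:
  assumes r: "rep v f \<phi>" and w: "w \<in> N" "\<phi> w \<noteq> 0"
  shows "\<phi> (x * w) = beta v f x * \<phi> w"
proof -
  have "\<phi> (x * w) * cnj (\<phi> w) = beta v f (x * (w * adj w))"
    using rep_cnj_range[OF r w, of "x * w"] by (simp add: mult.assoc)
  also have "\<dots> = beta v f x * (\<phi> w * cnj (\<phi> w))"
    by (simp add: F_D_right rep_in[OF r] N_norm w(1) rep_cnj_range[OF r w])
  finally show ?thesis
    using w(2) by simp
qed

section \<open>Source, range, product and inverse through representatives\<close>

lemma rep_unique:
  assumes "rep v f \<phi>" "rep v' f' \<phi>"
  shows "f = f'" "beta v f = beta v' f'"
proof -
  \<comment> \<open>Since \<open>\<phi> v = 1\<close>, the functions \<open>\<phi> (v * x)\<close>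
    and \<open>\<phi> (x * v)\<close> of \<open>x\<close> are the source and the range, whatever
    representative is used.\<close>
  have v: "v \<in> N" "\<phi> v = 1" "\<phi> v \<noteq> 0"
    using assms(1) rep_self[OF assms(1)] by (auto simp: rep_def)
  show "f = f'"
    using rep_mult_source[OF assms(1) v(1,3)] rep_mult_source[OF assms(2) v(1,3)] v(2) by auto
  show "beta v f = beta v' f'"
    using rep_mult_range[OF assms(1) v(1,3)] rep_mult_range[OF assms(2) v(1,3)] v(2) by auto
qed

text \<open>The choice operator admits unnormalized brackets; normalizing them reduces its
  uniqueness to \<open>rep_unique\<close>.\<close>

lemma E_src_rep:
  assumes r: "rep v f \<phi>"
  shows "E_src D F \<phi> = f"
  unfolding E_src_def
proof (rule some_equality)
  show "\<exists>v. v \<in> N \<and> f \<in> F \<and> f (adj v * v) \<noteq> 0 \<and> \<phi> = bracket v f"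
    using r rep_bracket[OF r] by (metis rep_def zero_neq_one)
  show "g = f" if "\<exists>v. v \<in> N \<and> g \<in> F \<and> g (adj v * v) \<noteq> 0 \<and> \<phi> = bracket v g" for g
    using that r by (metis bracket_normalize rep_unique(1))
qed

lemma E_rng_rep:
  assumes r: "rep v f \<phi>"
  shows "E_rng D F \<phi> = beta v f"
  unfolding E_rng_def
proof (rule some_equality)
  show "\<exists>v' f'. v' \<in> N \<and> f' \<in> F \<and> f' (adj v' * v') \<noteq> 0 \<and> \<phi> = bracket v' f' \<and> beta v f = beta v' f'"
    using r rep_bracket[OF r] by (metis rep_def zero_neq_one)
  show "g = beta v f"
    if "\<exists>v' f'. v' \<in> N \<and> f' \<in> F \<and> f' (adj v' * v') \<noteq> 0 \<and> \<phi> = bracket v' f' \<and> g = beta v' f'" for g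
    using that r by (metis bracket_normalize rep_unique(2))
qed

lemma rep_mult:
  assumes r1: "rep v1 (beta v2 f) \<phi>1" and r2: "rep v2 f \<phi>2"
  shows "rep (v1 * v2) f (\<lambda>x. \<phi>2 (adj v1 * x))" "beta (v1 * v2) f = beta v1 (beta v2 f)"
proof -
  show m: "rep (v1 * v2) f (\<lambda>x. \<phi>2 (adj v1 * x))"
    using r1 r2 rep_beta[OF r2] unfolding rep_def
    by (auto simp: adj_mult mult.assoc normalizers_mult)
  show "beta (v1 * v2) f = beta v1 (beta v2 f)"
    unfolding rep_beta[OF m] rep_beta[OF r1] by (simp add: rep_beta[OF r2] adj_mult mult.assoc)
qed

text \<open>The right-hand side shows that the product does not depend on how \<open>\<phi>1\<close> is represented.\<close>

lemma rep_product:
  assumes r1: "rep v1 (beta v2 f) \<phi>1" and r2: "rep v2 f \<phi>2" and w: "w \<in> N" "\<phi>1 w \<noteq> 0"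
  shows "\<phi>2 (adj w * x) = \<phi>1 (x * adj v2) * cnj (\<phi>1 w)"
proof -
  have v2: "v2 \<in> N" "f \<in> F" "f (adj v2 * v2) = 1" "\<phi>2 = (\<lambda>x. f (adj v2 * x))"
    using r2 by (auto simp: rep_def)
  have "\<phi>1 (x * adj v2) * cnj (\<phi>1 w) = beta v2 f (adj w * (x * adj v2))"
    by (simp add: rep_cnj_source[OF r1 w])
  also have "\<dots> = f (adj v2 * (adj w * x) * (adj v2 * v2))"
    by (simp add: rep_beta[OF r2] mult.assoc)
  also have "\<dots> = \<phi>2 (adj w * x)"
    by (simp add: F_D_right[OF v2(2) N_norm(1)[OF v2(1)]] v2(3,4))
  finally show ?thesis ..
qed

text \<open>Both sides equal \<open>\<phi>1 (x * adj v2)\<close>: take for \<open>w\<close> in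
  \<open>rep_product\<close> the two representing elements of \<open>\<phi>1\<close>, where it has
  value 1.\<close>

lemma rep_product_unique:
  assumes r1: "rep v1 (beta v2 f) \<phi>1" and r2: "rep v2 f \<phi>2"
    and r1': "rep w1 (beta w2 f') \<phi>1" and r2': "rep w2 f' \<phi>2"
  shows "\<phi>2 (adj v1 * x) = \<phi>2 (adj w1 * x)"
  using rep_product[OF r1 r2, of v1] rep_product[OF r1 r2, of w1] rep_self[OF r1] rep_self[OF r1']
    rep_in[OF r1] rep_in[OF r1'] by simp

lemma E_mult_rep:
  assumes r1: "rep v1 (beta v2 f) \<phi>1" and r2: "rep v2 f \<phi>2"
  shows "E_mult D F \<phi>1 \<phi>2 = (\<lambda>x. \<phi>2 (adj v1 * x))"
  unfolding E_mult_def
proof (rule some_equality)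
  let ?P = "\<lambda>\<psi> v1 v2 f. v1 \<in> N \<and> v2 \<in> N \<and> f \<in> F \<and>
       f (adj v2 * v2) \<noteq> 0 \<and> beta v2 f (adj v1 * v1) \<noteq> 0 \<and>
       \<phi>2 = bracket v2 f \<and> \<phi>1 = bracket v1 (beta v2 f) \<and> \<psi> = bracket (v1 * v2) f"
  have "?P (\<lambda>x. \<phi>2 (adj v1 * x)) v1 v2 f"
    using r1 r2 rep_bracket[OF r1] rep_bracket[OF r2] rep_bracket[OF rep_mult(1)[OF r1 r2]]
    unfolding rep_def by auto
  then show "\<exists>v1' v2 f. ?P (\<lambda>x. \<phi>2 (adj v1 * x)) v1' v2 f"
    by blast
  fix \<psi> assume "\<exists>v1 v2 f. ?P \<psi> v1 v2 f"
  then obtain w1 w2 g where P: "?P \<psi> w1 w2 g"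
    by blast
  obtain c2 :: real where c2: "c2 > 0" "rep (scaleC c2 w2) g \<phi>2" "beta (scaleC c2 w2) g = beta w2 g"
    using P bracket_normalize by metis
  obtain c1 :: real where c1: "c1 > 0" "rep (scaleC c1 w1) (beta w2 g) \<phi>1"
    using P bracket_normalize[of w1 "beta w2 g"] F_beta by metis
  let ?w = "scaleC c1 w1 * scaleC c2 w2"
  have r: "rep ?w g (\<lambda>x. \<phi>2 (adj (scaleC c1 w1) * x))"
    using rep_mult(1) c1(2) c2(2,3) by metis
  have w: "?w = scaleC (c1 * c2) (w1 * w2)"
    by (simp add: mult_scaleC_left mult_scaleC_right scaleC_scaleC mult.commute)
  have g: "g \<in> F" "w1 * w2 \<in> N"
    using P by (auto intro: normalizers_mult)
  note s = is_state_simps[OF F_state[OF g(1)]]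
  have nz: "g (adj (w1 * w2) * (w1 * w2)) \<noteq> 0"
    using r g unfolding w rep_def
    by (auto simp: adj_scaleC mult_scaleC_left mult_scaleC_right s)
  obtain c :: real where c: "c > 0" "rep (scaleC c (w1 * w2)) g \<psi>"
    using bracket_normalize[OF g(2,1) nz] P by metis
  \<comment> \<open>Both \<open>c\<close> and \<open>c1 * c2\<close> normalize
    \<open>w1 * w2\<close>. Being positive with equal squares, they coincide, so normalizing the
    factors also normalizes the product.\<close>
  have "c * c * Re (g (adj (w1 * w2) * (w1 * w2))) = 1"
    using c(2) g unfolding rep_def by (auto simp: adj_scaleC mult_scaleC_left mult_scaleC_right s complex_eq_iff)
  moreover have "(c1 * c2) * (c1 * c2) * Re (g (adj (w1 * w2) * (w1 * w2))) = 1"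
    using r g unfolding w rep_def by (auto simp: adj_scaleC mult_scaleC_left mult_scaleC_right s complex_eq_iff)
  ultimately have "c\<^sup>2 = (c1 * c2)\<^sup>2"
    by (metis mult_cancel_right mult_zero_right power2_eq_square zero_neq_one)
  then have "c = c1 * c2"
    using c(1) c1(1) c2(1) by (simp add: power2_eq_iff_nonneg)
  then have "\<psi> = (\<lambda>x. \<phi>2 (adj (scaleC c1 w1) * x))"
    using c(2) r w by (simp add: rep_def)
  moreover have "rep (scaleC c1 w1) (beta (scaleC c2 w2) g) \<phi>1"
    using c1(2) c2(3) by simp
  ultimately show "\<psi> = (\<lambda>x. \<phi>2 (adj v1 * x))"
    using rep_product_unique[OF r1 r2 _ c2(2)] by auto
qed

lemma rep_inv:
  assumes r: "rep v f \<phi>"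
  shows "rep (adj v) (beta v f) (E_inv \<phi>)" "beta (adj v) (beta v f) = f"
proof -
  have v: "v \<in> N" "f \<in> F" "f (adj v * v) = 1" "\<phi> = (\<lambda>x. f (adj v * x))"
    using r by (auto simp: rep_def)
  note D = F_D_left[OF v(2) N_norm(1)[OF v(1)]] F_D_right[OF v(2) N_norm(1)[OF v(1)]]
  have "beta v f (v * x) = f (x * v)" for x
    using D(1)[of "x * v"] by (simp add: rep_beta[OF r] v(3) mult.assoc)
  moreover have "cnj (f (adj v * adj x)) = f (x * v)" for x
    using state_adj[OF F_state[OF v(2)], of "adj v * adj x"] by (simp add: adj_mult adj_adj)
  ultimately have "E_inv \<phi> = (\<lambda>x. beta v f (adj (adj v) * x))"
    by (auto simp: E_inv_def adj_adj v(4))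
  moreover have "beta v f (adj (adj v) * adj v) = 1"
    using D(1)[of "adj v * v"] by (simp add: rep_beta[OF r] v(3) mult.assoc adj_adj)
  ultimately show i: "rep (adj v) (beta v f) (E_inv \<phi>)"
    using v(1) rep_in[OF r] by (auto simp: rep_def normalizers_adj)
  \<comment> \<open>The element \<open>adj v * v\<close> lies in \<open>D\<close> and has value 1
    under \<open>f\<close>, so it is absorbed on both sides of \<open>x\<close>.\<close>
  have "beta v f (v * x * adj v) = f x" for x
  proof -
    have "beta v f (v * x * adj v) = f ((adj v * v) * (x * (adj v * v)))"
      by (simp add: rep_beta[OF r] mult.assoc)
    then show ?thesis
      by (simp add: D v(3))
  qed
  then show "beta (adj v) (beta v f) = f"
    by (auto simp: rep_beta[OF i] adj_adj)
qed

section \<open>The algebraic groupoid of normalized functionals\<close>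

lemma groupoid_E1: "groupoid (E1 D F) F (E_src D F) (E_rng D F) (E_mult D F) E_inv"
proof -
  \<comment> \<open>Composability means that the base state of \<open>x\<close> is
    \<open>beta v f\<close> for the chosen representative of \<open>y\<close>.\<close>
  have prod: "\<exists>u v f. rep u (beta v f) x \<and> rep v f y"
    if "x \<in> E1 D F" "y \<in> E1 D F" "E_src D F x = E_rng D F y" for x y
    using that unfolding E1_rep by (metis E_src_rep E_rng_rep)
  have m: "E_mult D F x y \<in> E1 D F \<and> E_src D F (E_mult D F x y) = E_src D F y \<and>
      E_rng D F (E_mult D F x y) = E_rng D F x"
    if hyp: "x \<in> E1 D F" "y \<in> E1 D F" "E_src D F x = E_rng D F y" for x y
  proof -
    obtain u v f where x: "rep u (beta v f) x" and y: "rep v f y"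
      using prod[OF hyp] by blast
    note xy = rep_mult[OF x y, folded E_mult_rep[OF x y]]
    show ?thesis
      using E1_rep xy E_src_rep[OF xy(1)] E_rng_rep[OF xy(1)] E_src_rep[OF y] E_rng_rep[OF x] by auto
  qed
  have assoc: "E_mult D F (E_mult D F x y) z = E_mult D F x (E_mult D F y z)"
    if xyz: "x \<in> E1 D F" "y \<in> E1 D F" "z \<in> E1 D F"
      "E_src D F x = E_rng D F y" "E_src D F y = E_rng D F z" for x y z
  proof -
    obtain v w f where y: "rep v (beta w f) y" and z: "rep w f z"
      using prod[OF xyz(2,3,5)] by blast
    obtain u where x: "rep u (beta v (beta w f)) x"
      using xyz(1,4) unfolding E1_rep by (metis E_src_rep E_rng_rep y)
    note xy = rep_mult[OF x y, folded E_mult_rep[OF x y]]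
      and yz = rep_mult[OF y z, folded E_mult_rep[OF y z]]
    \<comment> \<open>Because \<open>beta\<close> turns products into compositions, \<open>x\<close>
      has the base state needed to be multiplied with \<open>yz\<close>; both bracketings then
      reduce to associativity in the algebra.\<close>
    have x': "rep u (beta (v * w) f) x"
      using x yz(2) by simp
    show ?thesis
      unfolding E_mult_rep[OF xy(1) z] E_mult_rep[OF x' yz(1)]
      by (simp add: E_mult_rep[OF y z] adj_mult mult.assoc)
  qed
  have unit: "E_mult D F (E_rng D F x) x = x \<and> E_mult D F x (E_src D F x) = x"
    if hyp: "x \<in> E1 D F" for x
  proof -
    obtain v f where r: "rep v f x"
      using hyp unfolding E1_rep by blast
    have "rep v (beta 1 f) x"
      using r rep_unit(2) rep_in(1)[OF r] by simp
    then have "E_mult D F x f = (\<lambda>y. f (adj v * y))"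
      using E_mult_rep rep_unit(1) rep_in(1)[OF r] by blast
    then have "E_mult D F x f = x"
      using r by (simp add: rep_def)
    moreover have "E_mult D F (beta v f) x = x"
      using E_mult_rep[OF rep_unit(1)[OF rep_in(2)[OF r]] r] by simp
    ultimately show ?thesis
      by (simp add: E_src_rep[OF r] E_rng_rep[OF r])
  qed
  have inv: "E_inv x \<in> E1 D F \<and> E_src D F (E_inv x) = E_rng D F x \<and>
      E_rng D F (E_inv x) = E_src D F x \<and> E_mult D F (E_inv x) x = E_src D F x \<and>
      E_mult D F x (E_inv x) = E_rng D F x"
    if hyp: "x \<in> E1 D F" for x
  proof -
    obtain v f where r: "rep v f x"
      using hyp unfolding E1_rep by blast
    note i = rep_inv[OF r]
    have v: "v \<in> N" "f \<in> F" "f (adj v * v) = 1" "x = (\<lambda>x. f (adj v * x))"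
      using r by (auto simp: rep_def)
    have 1: "x (v * y) = f y" for y
      using rep_mult_source[OF r v(1)] rep_self[OF r] by simp
    have g: "beta v f (v * adj v) = 1" "E_inv x = (\<lambda>x. beta v f (v * x))"
      using i(1) by (auto simp: rep_def adj_adj)
    have 2: "E_inv x (adj v * y) = beta v f y" for y
      using F_D_left[OF rep_in(2)[OF r] N_norm(2)[OF v(1)], of y] g by (simp add: mult.assoc)
    have "E_mult D F (E_inv x) x = f"
      using E_mult_rep[OF i(1) r] 1 by (simp add: adj_adj)
    moreover have "E_mult D F x (E_inv x) = beta v f"
      using E_mult_rep[of v "adj v" "beta v f" x, OF _ i(1)] r i(2) 2 by simp
    ultimately show ?thesis
      using i E_src_rep[OF r] E_rng_rep[OF r] E_src_rep[OF i(1)] E_rng_rep[OF i(1)] E1_rep by auto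
  qed
  have "F \<subseteq> E1 D F" "\<forall>u\<in>F. E_src D F u = u \<and> E_rng D F u = u"
    using E1_rep rep_unit E_src_rep E_rng_rep by (blast, metis)
  moreover have "\<forall>x\<in>E1 D F. E_src D F x \<in> F \<and> E_rng D F x \<in> F"
    using E1_rep E_src_rep E_rng_rep rep_in by metis
  ultimately show ?thesis
    unfolding groupoid_def by (intro conjI ballI impI) (simp_all add: m assoc unit inv)
qed

lemma groupoid_E1_simps:
  shows "f \<in> F \<Longrightarrow> f \<in> E1 D F" "f \<in> F \<Longrightarrow> E_src D F f = f" "f \<in> F \<Longrightarrow> E_rng D F f = f"
    "\<phi> \<in> E1 D F \<Longrightarrow> E_src D F \<phi> \<in> F" "\<phi> \<in> E1 D F \<Longrightarrow> E_rng D F \<phi> \<in> F"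
    "\<phi> \<in> E1 D F \<Longrightarrow> E_inv \<phi> \<in> E1 D F"
    "\<phi> \<in> E1 D F \<Longrightarrow> E_rng D F (E_inv \<phi>) = E_src D F \<phi>"
    "\<phi> \<in> E1 D F \<Longrightarrow> E_src D F (E_inv \<phi>) = E_rng D F \<phi>"
    "\<phi> \<in> E1 D F \<Longrightarrow> E_mult D F (E_rng D F \<phi>) \<phi> = \<phi>"
    "\<phi> \<in> E1 D F \<Longrightarrow> E_mult D F \<phi> (E_src D F \<phi>) = \<phi>"
    "\<phi> \<in> E1 D F \<Longrightarrow> E_mult D F (E_inv \<phi>) \<phi> = E_src D F \<phi>"
    "\<phi> \<in> E1 D F \<Longrightarrow> E_mult D F \<phi> (E_inv \<phi>) = E_rng D F \<phi>"
  using groupoid_E1 unfolding groupoid_def by blast+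

lemma groupoid_E1_mult:
  assumes "\<phi> \<in> E1 D F" "\<psi> \<in> E1 D F" "E_src D F \<phi> = E_rng D F \<psi>"
  shows "E_mult D F \<phi> \<psi> \<in> E1 D F" "E_src D F (E_mult D F \<phi> \<psi>) = E_src D F \<psi>"
    "E_rng D F (E_mult D F \<phi> \<psi>) = E_rng D F \<phi>"
  using groupoid_E1 assms unfolding groupoid_def by blast+

lemma E1_nonzero:
  assumes "\<phi> \<in> E1 D F"
  obtains w where "w \<in> N" "\<phi> w \<noteq> 0"
proof -
  obtain v f where "rep v f \<phi>"
    using assms unfolding E1_rep by blast
  then show thesis
    using that rep_self[of v f \<phi>] rep_in(3)[of v f \<phi>] by simp
qed

text \<open>These formulas mention no representative: for fixed \<open>w\<close> they hold wherever
  \<open>\<phi> w \<noteq> 0\<close>, which is the form that continuity requires.\<close>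

lemma E1_eval:
  assumes "\<phi> \<in> E1 D F" "w \<in> N" "\<phi> w \<noteq> 0"
  shows "\<phi> (w * x) = \<phi> w * E_src D F \<phi> x"
    and "\<phi> (x * w) = E_rng D F \<phi> x * \<phi> w"
    and "E_src D F \<phi> (adj w * x) = \<phi> x * cnj (\<phi> w)"
    and "E_rng D F \<phi> (x * adj w) = \<phi> x * cnj (\<phi> w)"
proof -
  obtain v f where r: "rep v f \<phi>"
    using assms(1) unfolding E1_rep by blast
  note [simp] = E_src_rep[OF r] E_rng_rep[OF r]
  show "\<phi> (w * x) = \<phi> w * E_src D F \<phi> x"
    using rep_mult_source[OF r assms(2,3)] by simp
  show "\<phi> (x * w) = E_rng D F \<phi> x * \<phi> w"
    using rep_mult_range[OF r assms(2,3)] by simp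
  show "E_src D F \<phi> (adj w * x) = \<phi> x * cnj (\<phi> w)"
    using rep_cnj_source[OF r assms(2,3)] by simp
  show "E_rng D F \<phi> (x * adj w) = \<phi> x * cnj (\<phi> w)"
    using rep_cnj_range[OF r assms(2,3)] by simp
qed

lemma E1_eval_mult:
  assumes "\<phi> \<in> E1 D F" "\<psi> \<in> E1 D F" "E_src D F \<phi> = E_rng D F \<psi>" "w \<in> N" "\<phi> w \<noteq> 0"
  shows "\<psi> (adj w * x) = E_mult D F \<phi> \<psi> x * cnj (\<phi> w)"
proof -
  obtain u g v f where r: "rep u g \<phi>" "rep v f \<psi>"
    using assms(1,2) unfolding E1_rep by blast
  then have u: "rep u (beta v f) \<phi>"
    using assms(3) E_src_rep[of u g \<phi>] E_rng_rep[of v f \<psi>] by simp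
  have "\<psi> (adj u * x) = \<phi> (x * adj v)"
    using rep_product[OF u r(2) rep_in(3)[OF u], of x] rep_self[OF u] by simp
  then show ?thesis
    using rep_product[OF u r(2) assms(4,5)] E_mult_rep[OF u r(2)] by simp
qed

text \<open>The functional is conjugate linear in its representing element, so the phase
  \<open>z\<close> is realized by \<open>scaleC (cnj z) v\<close>.\<close>

lemma E1_scale:
  assumes "\<phi> \<in> E1 D F" "cmod z = 1"
  shows "(\<lambda>x. z * \<phi> x) \<in> E1 D F" "E_src D F (\<lambda>x. z * \<phi> x) = E_src D F \<phi>"
    "E_rng D F (\<lambda>x. z * \<phi> x) = E_rng D F \<phi>"
proof -
  obtain v f where r: "rep v f \<phi>"
    using assms(1) unfolding E1_rep by blast
  have z: "cnj z * z = 1"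
    using assms(2) complex_norm_square[of z] by (simp add: mult.commute)
  note s = is_state_simps[OF F_state[OF rep_in(1)[OF r]]]
  have r': "rep (scaleC (cnj z) v) f (\<lambda>x. z * \<phi> x)"
    using r z unfolding rep_def
    by (auto simp: N_scaleC adj_scaleC mult_scaleC_left mult_scaleC_right s simp flip: mult.assoc)
  have b: "beta (scaleC (cnj z) v) f = beta v f"
    unfolding rep_beta[OF r] rep_beta[OF r']
    using z by (simp add: adj_scaleC mult_scaleC_left mult_scaleC_right s flip: mult.assoc)
  show "(\<lambda>x. z * \<phi> x) \<in> E1 D F"
    using r' E1_rep by blast
  show "E_src D F (\<lambda>x. z * \<phi> x) = E_src D F \<phi>" "E_rng D F (\<lambda>x. z * \<phi> x) = E_rng D F \<phi>"
    using E_src_rep[OF r] E_src_rep[OF r'] E_rng_rep[OF r] E_rng_rep[OF r'] b by simp_all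
qed

text \<open>Both products are computed from the same \<open>w\<close>. The phase \<open>a\<close>
  enters through \<open>cnj (a * \<phi> w)\<close> and comes out as \<open>a\<close> because
  \<open>a * cnj a = 1\<close>.\<close>

lemma E_mult_scale:
  assumes "\<phi> \<in> E1 D F" "\<psi> \<in> E1 D F" "E_src D F \<phi> = E_rng D F \<psi>" "cmod a = 1" "cmod b = 1"
  shows "E_mult D F (\<lambda>x. a * \<phi> x) (\<lambda>x. b * \<psi> x) = (\<lambda>x. a * b * E_mult D F \<phi> \<psi> x)"
proof
  fix x
  obtain w where w: "w \<in> N" "\<phi> w \<noteq> 0"
    using E1_nonzero[OF assms(1)] .
  have a: "a * cnj a = 1"
    using assms(4) complex_norm_square[of a] by simp
  have "a \<noteq> 0"
    using a by auto
  then have "b * \<psi> (adj w * x) = E_mult D F (\<lambda>x. a * \<phi> x) (\<lambda>x. b * \<psi> x) x * cnj (a * \<phi> w)"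
    using E1_eval_mult[OF E1_scale(1)[OF assms(1,4)] E1_scale(1)[OF assms(2,5)] _ w(1)] w(2) assms
    by (simp add: E1_scale)
  then have "(a * b) * (E_mult D F \<phi> \<psi> x * cnj (\<phi> w))
      = (a * cnj a) * (E_mult D F (\<lambda>x. a * \<phi> x) (\<lambda>x. b * \<psi> x) x * cnj (\<phi> w))"
    using E1_eval_mult[OF assms(1-3) w, of x] by (simp add: mult_ac)
  then show "E_mult D F (\<lambda>x. a * \<phi> x) (\<lambda>x. b * \<psi> x) x = a * b * E_mult D F \<phi> \<psi> x"
    using a w(2) by (simp add: mult.assoc)
qed

text \<open>The circle acts by scalars from either side, so its image is central.\<close>

lemma E_mult_iota:
  assumes "\<phi> \<in> E1 D F" "cmod z = 1"
  shows "E_mult D F (iota (z, E_rng D F \<phi>)) \<phi> = (\<lambda>x. z * \<phi> x)"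
    "E_mult D F \<phi> (iota (z, E_src D F \<phi>)) = (\<lambda>x. z * \<phi> x)"
  using E_mult_scale[of "E_rng D F \<phi>" \<phi> z 1] E_mult_scale[of \<phi> "E_src D F \<phi>" 1 z] assms
  by (simp_all add: iota_def groupoid_E1_simps)

text \<open>The real square root makes the dependence on \<open>f\<close> visibly continuous, away
  from the branch cut of \<open>csqrt\<close>.\<close>

lemma bracket_real:
  assumes "f \<in> F"
  shows "bracket v f = (\<lambda>x. f (adj v * x) / of_real (sqrt (Re (f (adj v * v)))))"
proof -
  have "csqrt (f (adj v * v)) = of_real (sqrt (Re (f (adj v * v))))"
    using state_norm_nonneg[OF F_state[OF assms], of v] by (metis of_real_sqrt)
  then show ?thesis
    by (simp add: bracket_def)
qed

lemma bracket_E1: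
  assumes "v \<in> N" "f \<in> F" "f (adj v * v) \<noteq> 0"
  shows "bracket v f \<in> E1 D F" "E_src D F (bracket v f) = f"
proof -
  obtain c :: real where "rep (scaleC c v) f (bracket v f)"
    using bracket_normalize[OF assms] by metis
  then show "bracket v f \<in> E1 D F" "E_src D F (bracket v f) = f"
    using E1_rep E_src_rep by blast+
qed

text \<open>An element of the groupoid is recovered from its source and one nonvanishing
  \<open>w\<close>, except for its phase at \<open>w\<close>. Compactness arguments and local
  sections rest on this.\<close>

lemma bracket_src:
  assumes "\<phi> \<in> E1 D F" "w \<in> N" "\<phi> w \<noteq> 0"
  shows "bracket w (E_src D F \<phi>) = (\<lambda>x. cnj (\<phi> w) / of_real (cmod (\<phi> w)) * \<phi> x)"
proof -
  have "Re (E_src D F \<phi> (adj w * w)) = (cmod (\<phi> w))\<^sup>2"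
    using E1_eval(3)[OF assms, of w] complex_norm_square[of "\<phi> w"] by (metis Re_complex_of_real)
  then show ?thesis
    by (simp add: bracket_real groupoid_E1_simps assms(1) E1_eval(3)[OF assms] mult.commute)
qed

subsection \<open>Absolute values\<close>

text \<open>Polarization: \<open>\<bar>1 + a\<bar>\<^sup>2\<close> and \<open>\<bar>1 - \<i> a\<bar>\<^sup>2\<close> together with \<open>\<bar>a\<bar>\<^sup>2\<close> determine \<open>a\<close>, so a state
  is recovered continuously from its absolute value.\<close>

definition unabs :: "('a \<Rightarrow> real) \<Rightarrow> 'a \<Rightarrow> complex" where
  "unabs h x = of_real (((h (1 + x))\<^sup>2 - 1 - (h x)\<^sup>2) / 2)
     + \<i> * of_real (((h (1 + scaleC (- \<i>) x))\<^sup>2 - 1 - (h x)\<^sup>2) / 2)"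

lemma unabs_absf:
  assumes "f \<in> F"
  shows "unabs (absf f) = f"
proof
  fix x
  note s = is_state_simps[OF F_state[OF assms]]
  show "unabs (absf f) x = f x"
    by (simp add: unabs_def absf_def s cmod_power2 complex_eq_iff) (simp add: power2_eq_square algebra_simps)
qed

lemma inj_on_absf: "inj_on absf F"
  by (metis inj_onI unabs_absf)

lemma absf_scale: "cmod z = 1 \<Longrightarrow> absf (\<lambda>x. z * \<phi> x) = absf \<phi>"
  by (simp add: absf_def norm_mult)

text \<open>The ratio of \<open>cmod (\<phi> (w * x))\<close> to \<open>cmod (\<phi> w)\<close>
  gives the absolute value of the source, hence the source itself. With equal sources, the formula
  for \<open>f (adj w * x)\<close> leaves only a constant phase.\<close>

lemma absf_eq:
  assumes "\<phi> \<in> E1 D F" "\<psi> \<in> E1 D F" "absf \<phi> = absf \<psi>"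
  obtains z where "cmod z = 1" "\<phi> = (\<lambda>x. z * \<psi> x)"
proof -
  obtain w where w: "w \<in> N" "\<phi> w \<noteq> 0"
    using E1_nonzero[OF assms(1)] .
  have abs: "cmod (\<phi> x) = cmod (\<psi> x)" for x
    using assms(3) by (metis absf_def)
  then have w': "\<psi> w \<noteq> 0"
    using w(2) by (metis norm_eq_zero)
  have "absf (E_src D F \<phi>) = absf (E_src D F \<psi>)"
  proof
    fix x
    have "cmod (\<phi> w) * cmod (E_src D F \<phi> x) = cmod (\<phi> w) * cmod (E_src D F \<psi> x)"
      using abs[of "w * x"] abs[of w] E1_eval(1)[OF assms(1) w] E1_eval(1)[OF assms(2) w(1) w']
      by (simp add: norm_mult)
    then show "absf (E_src D F \<phi>) x = absf (E_src D F \<psi>) x"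
      using w(2) by (simp add: absf_def)
  qed
  then have src: "E_src D F \<phi> = E_src D F \<psi>"
    using assms(1,2) inj_on_absf groupoid_E1_simps(4) by (auto dest: inj_onD)
  have eq: "\<phi> x = cnj (\<psi> w) / cnj (\<phi> w) * \<psi> x" for x
    using E1_eval(3)[OF assms(1) w, of x] E1_eval(3)[OF assms(2) w(1) w', of x] w(2) src
    by (simp add: field_simps)
  show thesis
  proof
    show "cmod (cnj (\<psi> w) / cnj (\<phi> w)) = 1"
      using abs[of w] w' by (simp add: norm_divide)
    show "\<phi> = (\<lambda>x. cnj (\<psi> w) / cnj (\<phi> w) * \<psi> x)"
      using eq by (rule ext)
  qed
qed

lemma absf_eq_src_rng:
  assumes "\<phi> \<in> E1 D F" "\<psi> \<in> E1 D F" "absf \<phi> = absf \<psi>"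
  shows "E_src D F \<phi> = E_src D F \<psi>" "E_rng D F \<phi> = E_rng D F \<psi>"
proof -
  obtain z where "cmod z = 1" "\<phi> = (\<lambda>x. z * \<psi> x)"
    using absf_eq[OF assms] .
  then show "E_src D F \<phi> = E_src D F \<psi>" "E_rng D F \<phi> = E_rng D F \<psi>"
    using E1_scale[OF assms(2)] by auto
qed

section \<open>The induced groupoid of absolute values\<close>

lemma R_src_absf: "\<phi> \<in> E1 D F \<Longrightarrow> R_src D F (absf \<phi>) = absf (E_src D F \<phi>)"
  unfolding R_src_def by (rule some_equality) (auto, metis absf_eq_src_rng(1))

lemma R_rng_absf: "\<phi> \<in> E1 D F \<Longrightarrow> R_rng D F (absf \<phi>) = absf (E_rng D F \<phi>)"
  unfolding R_rng_def by (rule some_equality) (auto, metis absf_eq_src_rng(2))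

lemma R_composable:
  assumes "\<phi> \<in> E1 D F" "\<psi> \<in> E1 D F"
  shows "R_src D F (absf \<phi>) = R_rng D F (absf \<psi>) \<longleftrightarrow> E_src D F \<phi> = E_rng D F \<psi>"
  using assms inj_on_absf by (auto simp: R_src_absf R_rng_absf groupoid_E1_simps dest: inj_onD)

text \<open>Other lifts of the two factors differ by phases, and these multiply the product by a
  phase.\<close>

lemma R_mult_absf:
  assumes "\<phi> \<in> E1 D F" "\<psi> \<in> E1 D F" "E_src D F \<phi> = E_rng D F \<psi>"
  shows "R_mult D F (absf \<phi>) (absf \<psi>) = absf (E_mult D F \<phi> \<psi>)"
  unfolding R_mult_def
proof (rule some_equality)
  fix \<sigma>
  assume "\<exists>\<phi>1\<in>E1 D F. \<exists>\<phi>2\<in>E1 D F. E_src D F \<phi>1 = E_rng D F \<phi>2 \<and>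
    absf \<phi> = absf \<phi>1 \<and> absf \<psi> = absf \<phi>2 \<and> \<sigma> = absf (E_mult D F \<phi>1 \<phi>2)"
  then obtain \<phi>1 \<phi>2 where *: "\<phi>1 \<in> E1 D F" "\<phi>2 \<in> E1 D F" "absf \<phi>1 = absf \<phi>" "absf \<phi>2 = absf \<psi>"
    "\<sigma> = absf (E_mult D F \<phi>1 \<phi>2)"
    by metis
  obtain a where a: "cmod a = 1" "\<phi>1 = (\<lambda>x. a * \<phi> x)"
    using absf_eq[OF *(1) assms(1) *(3)] .
  obtain b where b: "cmod b = 1" "\<phi>2 = (\<lambda>x. b * \<psi> x)"
    using absf_eq[OF *(2) assms(2) *(4)] .
  show "\<sigma> = absf (E_mult D F \<phi> \<psi>)"
    using E_mult_scale[OF assms a(1) b(1)] a b *(5) by (simp add: absf_scale norm_mult)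
qed (use assms in blast)

lemma R_inv_absf: "R_inv (absf \<phi>) = absf (E_inv \<phi>)"
  by (simp add: R_inv_def absf_def E_inv_def)

text \<open>All axioms descend along \<open>absf\<close>; injectivity on \<open>F\<close> ensures
  that composable absolute values have composable lifts.\<close>

lemma groupoid_R: "groupoid (R D F) (absf ` F) (R_src D F) (R_rng D F) (R_mult D F) R_inv"
proof -
  note simps = R_src_absf R_rng_absf R_mult_absf R_inv_absf groupoid_E1_mult groupoid_E1_simps
    inj_on_eq_iff[OF inj_on_absf]
  have "R_mult D F (R_mult D F (absf x) (absf y)) (absf z) = R_mult D F (absf x) (R_mult D F (absf y) (absf z))"
    if "x \<in> E1 D F" "y \<in> E1 D F" "z \<in> E1 D F" "E_src D F x = E_rng D F y" "E_src D F y = E_rng D F z"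
    for x y z
  proof -
    have "E_mult D F (E_mult D F x y) z = E_mult D F x (E_mult D F y z)"
      using groupoid_E1 that unfolding groupoid_def by blast
    then show ?thesis
      using that by (simp add: simps)
  qed
  then show ?thesis
    unfolding groupoid_def R_def by (auto simp: simps)
qed

lemma R_nonzero:
  assumes "h \<in> R D F"
  obtains w where "w \<in> N" "h w > 0"
proof -
  obtain \<phi> where \<phi>: "\<phi> \<in> E1 D F" "h = absf \<phi>"
    using assms by (auto simp: R_def)
  then show thesis
    using that E1_nonzero[OF \<phi>(1)] by (auto simp: absf_def)
qed

lemma R_eval:
  assumes "h \<in> R D F" "w \<in> N" "h w \<noteq> 0"
  shows "h (w * x) = h w * R_src D F h x"
    and "h (x * w) = R_rng D F h x * h w"
    and "R_src D F h (adj w * x) = h x * h w"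
    and "R_rng D F h (x * adj w) = h x * h w"
proof -
  obtain \<phi> where \<phi>: "\<phi> \<in> E1 D F" "h = absf \<phi>"
    using assms(1) by (auto simp: R_def)
  then have w: "\<phi> w \<noteq> 0"
    using assms(3) by (auto simp: absf_def)
  note e = E1_eval[OF \<phi>(1) assms(2) w] R_src_absf[OF \<phi>(1)] R_rng_absf[OF \<phi>(1)]
  show "h (w * x) = h w * R_src D F h x" "h (x * w) = R_rng D F h x * h w"
    "R_src D F h (adj w * x) = h x * h w" "R_rng D F h (x * adj w) = h x * h w"
    unfolding \<phi>(2) e by (simp_all add: absf_def e norm_mult)
qed

lemma R_eval_mult:
  assumes "h \<in> R D F" "k \<in> R D F" "R_src D F h = R_rng D F k" "w \<in> N" "h w \<noteq> 0"
  shows "k (adj w * x) = R_mult D F h k x * h w"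
proof -
  obtain \<phi> \<psi> where \<phi>: "\<phi> \<in> E1 D F" "h = absf \<phi>" "\<psi> \<in> E1 D F" "k = absf \<psi>"
    using assms(1,2) by (auto simp: R_def)
  have c: "E_src D F \<phi> = E_rng D F \<psi>"
    using assms(3) R_composable[OF \<phi>(1,3)] \<phi> by simp
  show ?thesis
    using E1_eval_mult[OF \<phi>(1,3) c assms(4), of x] assms(5) R_mult_absf[OF \<phi>(1,3) c]
    unfolding \<phi> by (simp add: absf_def norm_mult)
qed

subsection \<open>Topological structure\<close>

lemma compact_F: "compact F"
proof -
  have "closed F"
    using cover by (simp add: compatible_cover_def)
  moreover have "F \<subseteq> {f. \<forall>x. norm (f x) \<le> norm x}"
    using F_state unfolding is_state_def by blast
  ultimately show ?thesis
    using compact_Int_closed[OF compact_fun_cball, of F norm] by (simp add: Int_absorb1)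
qed

lemma continuous_absf: "continuous_on S absf"
  unfolding absf_def by (intro continuous_on_coordinatewise_then_product continuous_on_norm continuous_on_eval)

lemma continuous_unabs: "continuous_on S unabs"
  unfolding unabs_def[abs_def]
  by (intro continuous_on_coordinatewise_then_product continuous_intros continuous_on_eval) auto

lemma topological_groupoid_E1:
  "topological_groupoid (E1 D F) F (E_src D F) (E_rng D F) (E_mult D F) E_inv"
  unfolding topological_groupoid_def
proof (intro conjI groupoid_E1)
  note cont = continuous_on_coordinatewise_then_product continuous_on_divide continuous_on_cnj
    continuous_on_eval continuous_on_fst_eval continuous_on_snd_eval
  show "continuous_on (E1 D F) (E_src D F)"
  proof (rule continuous_on_if_locally_open)
    fix \<phi> assume "\<phi> \<in> E1 D F"
    then obtain w where w: "w \<in> N" "\<phi> w \<noteq> 0"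
      by (rule E1_nonzero)
    \<comment> \<open>One fixed \<open>w\<close> serves the whole neighbourhood, so the source is
      coordinatewise a quotient of evaluations.\<close>
    have "continuous_on (E1 D F \<inter> {\<phi>. \<phi> w \<noteq> 0}) (\<lambda>\<phi> x. \<phi> (w * x) / \<phi> w)"
      by (intro cont) auto
    then have "continuous_on (E1 D F \<inter> {\<phi>. \<phi> w \<noteq> 0}) (E_src D F)"
      by (rule continuous_on_eq) (use w(1) in \<open>auto simp: E1_eval(1)\<close>)
    then show "\<exists>U. open U \<and> \<phi> \<in> U \<and> continuous_on (E1 D F \<inter> U) (E_src D F)"
      using open_eval_nonzero[of w] w(2) by blast
  qed
  show "continuous_on (E1 D F) (E_rng D F)"
  proof (rule continuous_on_if_locally_open)
    fix \<phi> assume "\<phi> \<in> E1 D F"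
    then obtain w where w: "w \<in> N" "\<phi> w \<noteq> 0"
      by (rule E1_nonzero)
    have "continuous_on (E1 D F \<inter> {\<phi>. \<phi> w \<noteq> 0}) (\<lambda>\<phi> x. \<phi> (x * w) / \<phi> w)"
      by (intro cont) auto
    then have "continuous_on (E1 D F \<inter> {\<phi>. \<phi> w \<noteq> 0}) (E_rng D F)"
      by (rule continuous_on_eq) (use w(1) in \<open>auto simp: E1_eval(2)\<close>)
    then show "\<exists>U. open U \<and> \<phi> \<in> U \<and> continuous_on (E1 D F \<inter> U) (E_rng D F)"
      using open_eval_nonzero[of w] w(2) by blast
  qed
  show "continuous_on (E1 D F) E_inv"
    unfolding E_inv_def[abs_def] by (intro cont)
  let ?C = "composable (E1 D F) (E_src D F) (E_rng D F)"
  show "continuous_on ?C (\<lambda>(x, y). E_mult D F x y)"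
  proof (rule continuous_on_if_locally_open)
    fix p assume "p \<in> ?C"
    then have "fst p \<in> E1 D F"
      by (auto simp: composable_def)
    then obtain w where w: "w \<in> N" "fst p w \<noteq> 0"
      by (rule E1_nonzero)
    let ?U = "{p :: ('a \<Rightarrow> complex) \<times> ('a \<Rightarrow> complex). fst p w \<noteq> 0}"
    have "continuous_on (?C \<inter> ?U) (\<lambda>p x. snd p (adj w * x) / cnj (fst p w))"
      by (intro cont) auto
    then have "continuous_on (?C \<inter> ?U) (\<lambda>(x, y). E_mult D F x y)"
      by (rule continuous_on_eq) (use w(1) in \<open>auto simp: composable_def E1_eval_mult\<close>)
    moreover have "open ?U"
      by (intro open_Collect_neq cont continuous_on_const)
    ultimately show "\<exists>U. open U \<and> p \<in> U \<and> continuous_on (?C \<inter> U) (\<lambda>(x, y). E_mult D F x y)"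
      using w(2) by blast
  qed
qed

lemma topological_groupoid_R:
  "topological_groupoid (R D F) (absf ` F) (R_src D F) (R_rng D F) (R_mult D F) R_inv"
  unfolding topological_groupoid_def
proof (intro conjI groupoid_R)
  note cont = continuous_on_coordinatewise_then_product continuous_on_divide
    continuous_on_eval continuous_on_fst_eval continuous_on_snd_eval
  show "continuous_on (R D F) (R_src D F)"
  proof (rule continuous_on_if_locally_open)
    fix h assume "h \<in> R D F"
    then obtain w where w: "w \<in> N" "h w > 0"
      by (rule R_nonzero)
    have "continuous_on (R D F \<inter> {h. h w \<noteq> 0}) (\<lambda>h x. h (w * x) / h w)"
      by (intro cont) auto
    then have "continuous_on (R D F \<inter> {h. h w \<noteq> 0}) (R_src D F)"
      by (rule continuous_on_eq) (use w(1) in \<open>auto simp: R_eval(1)\<close>)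
    moreover have "h \<in> {h. h w \<noteq> 0}"
      using w(2) by simp
    ultimately show "\<exists>U. open U \<and> h \<in> U \<and> continuous_on (R D F \<inter> U) (R_src D F)"
      using open_eval_nonzero[of w] by blast
  qed
  show "continuous_on (R D F) (R_rng D F)"
  proof (rule continuous_on_if_locally_open)
    fix h assume "h \<in> R D F"
    then obtain w where w: "w \<in> N" "h w > 0"
      by (rule R_nonzero)
    have "continuous_on (R D F \<inter> {h. h w \<noteq> 0}) (\<lambda>h x. h (x * w) / h w)"
      by (intro cont) auto
    then have "continuous_on (R D F \<inter> {h. h w \<noteq> 0}) (R_rng D F)"
      by (rule continuous_on_eq) (use w(1) in \<open>auto simp: R_eval(2)\<close>)
    moreover have "h \<in> {h. h w \<noteq> 0}"
      using w(2) by simp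
    ultimately show "\<exists>U. open U \<and> h \<in> U \<and> continuous_on (R D F \<inter> U) (R_rng D F)"
      using open_eval_nonzero[of w] by blast
  qed
  show "continuous_on (R D F) R_inv"
    unfolding R_inv_def[abs_def] by (intro cont)
  let ?C = "composable (R D F) (R_src D F) (R_rng D F)"
  show "continuous_on ?C (\<lambda>(x, y). R_mult D F x y)"
  proof (rule continuous_on_if_locally_open)
    fix p assume "p \<in> ?C"
    then have "fst p \<in> R D F"
      by (auto simp: composable_def)
    then obtain w where w: "w \<in> N" "fst p w > 0"
      by (rule R_nonzero)
    let ?U = "{p :: ('a \<Rightarrow> real) \<times> ('a \<Rightarrow> real). fst p w \<noteq> 0}"
    have "continuous_on (?C \<inter> ?U) (\<lambda>p x. snd p (adj w * x) / fst p w)"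
      by (intro cont) auto
    then have "continuous_on (?C \<inter> ?U) (\<lambda>(x, y). R_mult D F x y)"
      by (rule continuous_on_eq) (use w(1) in \<open>auto simp: composable_def R_eval_mult\<close>)
    moreover have "open ?U"
      by (intro open_Collect_neq cont continuous_on_const)
    moreover have "p \<in> ?U"
      using w(2) by simp
    ultimately show "\<exists>U. open U \<and> p \<in> U \<and> continuous_on (?C \<inter> U) (\<lambda>(x, y). R_mult D F x y)"
      by blast
  qed
qed

section \<open>Local compactness\<close>

lemma locally_compact_E1_R:
  shows "locally_compact_space (top_of_set (E1 D F))" "locally_compact_space (top_of_set (R D F))"
proof -
  \<comment> \<open>The compact set consists of all \<open>z [w, f]\<close> with \<open>z\<close> on
    the circle and \<open>f (adj w * w)\<close> at least \<open>c\<^sup>2\<close>. The bound is a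
    closed condition on the compact \<open>F\<close> and keeps the denominators away from
    zero.\<close>
  have K: "\<exists>K. compact K \<and> K \<subseteq> E1 D F \<and> {\<phi> \<in> E1 D F. c < cmod (\<phi> w)} \<subseteq> K"
    if w: "w \<in> N" and c: "c > 0" for w c
  proof -
    define Fc where "Fc = F \<inter> {f. c\<^sup>2 \<le> Re (f (adj w * w))}"
    define m where "m = (\<lambda>p :: complex \<times> ('a \<Rightarrow> complex).
      (\<lambda>x. fst p * (snd p (adj w * x) / of_real (sqrt (Re (snd p (adj w * w)))))))"
    have Fc: "f \<in> F" "Re (f (adj w * w)) > 0" if "f \<in> Fc" for f
      using that less_le_trans[OF zero_less_power[OF c, of 2]] unfolding Fc_def by auto
    have m: "m (z, f) = (\<lambda>x. z * bracket w f x)" if "f \<in> F" for z f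
      using bracket_real[OF that] by (simp add: m_def)
    have "closed {f :: 'a \<Rightarrow> complex. c\<^sup>2 \<le> Re (f (adj w * w))}"
      by (intro closed_Collect_le continuous_on_const continuous_on_Re continuous_on_eval)
    then have "compact (circle \<times> Fc)"
      unfolding Fc_def circle_def by (intro compact_Times compact_sphere compact_Int_closed compact_F)
    moreover have "continuous_on (circle \<times> Fc) m"
      unfolding m_def
      by (intro continuous_on_coordinatewise_then_product continuous_on_mult continuous_on_divide
          continuous_on_fst continuous_on_id continuous_on_snd_eval continuous_on_of_real
          continuous_on_real_sqrt continuous_on_Re) (use Fc(2) in force)
    ultimately have "compact (m ` (circle \<times> Fc))"
      by (rule compact_continuous_image[rotated])
    moreover have "m ` (circle \<times> Fc) \<subseteq> E1 D F"
    proof clarify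
      fix z f assume zf: "z \<in> circle" "f \<in> Fc"
      have "f (adj w * w) \<noteq> 0"
        using Fc(2)[OF zf(2)] by auto
      then show "m (z, f) \<in> E1 D F"
        using E1_scale(1)[OF bracket_E1(1)[OF w Fc(1)[OF zf(2)]], of z] zf(1) m[OF Fc(1)[OF zf(2)]]
        by (simp add: circle_def)
    qed
    moreover have "\<phi> \<in> m ` (circle \<times> Fc)" if \<phi>: "\<phi> \<in> E1 D F" and "c < cmod (\<phi> w)" for \<phi>
    proof -
      have nz: "\<phi> w \<noteq> 0"
        using that(2) c by auto
      \<comment> \<open>The phase of \<open>\<phi> w\<close>, which undoes the conjugate phase
        appearing in \<open>bracket_src\<close>.\<close>
      let ?z = "\<phi> w / of_real (cmod (\<phi> w))"
      have src: "E_src D F \<phi> \<in> F"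
        using \<phi> by (rule groupoid_E1_simps)
      have "?z * (cnj (\<phi> w) / of_real (cmod (\<phi> w))) = 1"
        using nz complex_norm_square[of "\<phi> w"] by (simp add: power2_eq_square)
      then have "m (?z, E_src D F \<phi>) = \<phi>"
        unfolding m[OF src] bracket_src[OF \<phi> w nz] by (simp only: mult.assoc[symmetric] mult_1_left)
      moreover have "?z \<in> circle"
        using nz by (simp add: circle_def norm_divide)
      moreover have "Re (E_src D F \<phi> (adj w * w)) = (cmod (\<phi> w))\<^sup>2"
        using E1_eval(3)[OF \<phi> w nz, of w] complex_norm_square[of "\<phi> w"] by (metis Re_complex_of_real)
      then have "E_src D F \<phi> \<in> Fc"
        using src that(2) c by (simp add: Fc_def power_mono)
      ultimately show ?thesis
        by (metis SigmaI image_eqI)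
    qed
    ultimately show ?thesis
      by blast
  qed
  show "locally_compact_space (top_of_set (E1 D F))"
  proof (rule locally_compact_space_top_of_set)
    fix \<phi> assume "\<phi> \<in> E1 D F"
    then obtain w where w: "w \<in> N" "\<phi> w \<noteq> 0"
      by (rule E1_nonzero)
    \<comment> \<open>Half the value leaves room for a strict inequality, so the set
      \<open>c < cmod (\<phi> w)\<close> is an open neighbourhood.\<close>
    define c where "c = cmod (\<phi> w) / 2"
    have c: "c > 0" "c < cmod (\<phi> w)"
      using w(2) by (auto simp: c_def)
    obtain L where "compact L" "L \<subseteq> E1 D F" "{\<phi> \<in> E1 D F. c < cmod (\<phi> w)} \<subseteq> L"
      using K[OF w(1) c(1)] by blast
    moreover have "open {\<phi> :: 'a \<Rightarrow> complex. c < cmod (\<phi> w)}"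
      by (intro open_Collect_less continuous_on_const continuous_on_norm continuous_on_eval)
    ultimately show "\<exists>U K. open U \<and> compact K \<and> K \<subseteq> E1 D F \<and> \<phi> \<in> U \<and> E1 D F \<inter> U \<subseteq> K"
      using c(2) by (intro exI[of _ "{\<phi>. c < cmod (\<phi> w)}"] exI[of _ L]) auto
  qed
  show "locally_compact_space (top_of_set (R D F))"
  proof (rule locally_compact_space_top_of_set)
    fix h assume "h \<in> R D F"
    then obtain w where w: "w \<in> N" "h w > 0"
      by (rule R_nonzero)
    define c where "c = h w / 2"
    have c: "c > 0" "c < h w"
      using w(2) by (auto simp: c_def)
    obtain L where L: "compact L" "L \<subseteq> E1 D F" "{\<phi> \<in> E1 D F. c < cmod (\<phi> w)} \<subseteq> L"
      using K[OF w(1) c(1)] by blast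
    have "compact (absf ` L)"
      using L(1) continuous_absf by (rule compact_continuous_image[rotated])
    moreover have "open {h :: 'a \<Rightarrow> real. c < h w}"
      by (intro open_Collect_less continuous_on_const continuous_on_eval)
    moreover have "R D F \<inter> {h. c < h w} \<subseteq> absf ` L"
      using L(3) by (auto simp: R_def absf_def)
    moreover have "absf ` L \<subseteq> R D F"
      using L(2) by (auto simp: R_def)
    ultimately show "\<exists>U K. open U \<and> compact K \<and> K \<subseteq> R D F \<and> h \<in> U \<and> R D F \<inter> U \<subseteq> K"
      using c(2) by (intro exI[of _ "{h. c < h w}"] exI[of _ "absf ` L"]) auto
  qed
qed

section \<open>Open bisections and the etale property\<close>

text \<open>For normalizers \<open>w\<close> these sets cover \<open>R D F\<close> and serve at once
  as etale charts, bisections and trivializing neighbourhoods.\<close>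

definition nonvanishing :: "'a \<Rightarrow> ('a \<Rightarrow> real) set" where
  "nonvanishing w = {h \<in> R D F. h w \<noteq> 0}"

lemma openin_nonvanishing: "openin (top_of_set (R D F)) (nonvanishing w)"
  using openin_open_Int[OF open_eval_nonzero[of w], of "R D F"]
  by (simp add: nonvanishing_def Int_def)

lemma R_nonneg: "h \<in> R D F \<Longrightarrow> h x \<ge> 0"
  by (auto simp: R_def absf_def)

text \<open>This makes the unit space open, as an etale groupoid requires.\<close>

lemma units_R: "absf ` F = nonvanishing 1"
proof
  show "absf ` F \<subseteq> nonvanishing 1"
  proof clarify
    fix f assume "f \<in> F"
    then show "absf f \<in> nonvanishing 1"
      using groupoid_E1_simps(1)[of f] is_state_simps(6)[OF F_state, of f]
      by (simp add: nonvanishing_def R_def) (simp add: absf_def)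
  qed
  show "nonvanishing 1 \<subseteq> absf ` F"
  proof
    fix h assume "h \<in> nonvanishing 1"
    then have h: "h \<in> R D F" "h 1 \<noteq> 0"
      by (auto simp: nonvanishing_def)
    then have src: "R_src D F h \<in> absf ` F"
      by (auto simp: R_def R_src_absf groupoid_E1_simps)
    then obtain f where "f \<in> F" "R_src D F h = absf f"
      by blast
    then have "R_src D F h 1 = 1"
      using is_state_simps(6)[OF F_state, of f] by (simp add: absf_def)
    \<comment> \<open>With \<open>w = 1\<close> the source is \<open>h\<close> scaled by
      \<open>h 1\<close>. Evaluating at \<open>1\<close>, where the source is 1, forces
      \<open>h 1 = 1\<close>, so \<open>h\<close> is its own source.\<close>
    then have "h 1 * h 1 = 1"
      using R_eval(3)[OF h(1) N_one h(2), of 1] by simp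
    then have "h 1 = 1"
      using R_nonneg[OF h(1), of 1] by (simp add: square_eq_1_iff)
    then have "R_src D F h = h"
      using R_eval(3)[OF h(1) N_one h(2)] by auto
    then show "h \<in> absf ` F"
      using src by simp
  qed
qed

text \<open>If \<open>g\<close> is the range of \<open>h\<close>, then
  \<open>g (x * adj w) = h x * h w\<close> and \<open>g (w * adj w) = (h w)\<^sup>2\<close>, so the
  quotient returns \<open>h\<close>.\<close>

lemma homeomorphism_R_rng:
  assumes w: "w \<in> N"
  shows "homeomorphism (nonvanishing w) (absf ` F \<inter> nonvanishing (w * adj w)) (R_rng D F)
    (\<lambda>g x. g (x * adj w) / sqrt (g (w * adj w)))" (is "homeomorphism ?U ?V _ ?i")
proof -
  have 1: "R_rng D F h \<in> ?V \<and> ?i (R_rng D F h) = h" if "h \<in> ?U" for h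
  proof -
    have h: "h \<in> R D F" "h w \<noteq> 0"
      using that by (auto simp: nonvanishing_def)
    note e = R_eval(4)[OF h(1) w h(2)]
    have "R_rng D F h \<in> absf ` F"
      using h(1) by (auto simp: R_def R_rng_absf groupoid_E1_simps)
    moreover from this have "R_rng D F h \<in> R D F"
      unfolding units_R by (simp add: nonvanishing_def)
    moreover have "sqrt (h w * h w) = h w"
      using R_nonneg[OF h(1)] by simp
    ultimately show ?thesis
      using h(2) e by (simp add: nonvanishing_def)
  qed
  have 2: "?i g \<in> ?U \<and> R_rng D F (?i g) = g" if g: "g \<in> ?V" for g
  proof -
    obtain f where f: "f \<in> F" "g = absf f"
      using g by auto
    have nz: "f (adj (adj w) * adj w) \<noteq> 0"
      using g f by (simp add: nonvanishing_def adj_adj absf_def)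
    \<comment> \<open>The preimage of \<open>g\<close> is the absolute value of the inverse of an
      arrow starting at \<open>f\<close>, as inversion turns source into range.\<close>
    define \<phi> where "\<phi> = bracket (adj w) f"
    have \<phi>: "\<phi> \<in> E1 D F" "E_src D F \<phi> = f"
      using bracket_E1[OF normalizers_adj[OF w] f(1) nz] by (auto simp: \<phi>_def)
    have "absf (E_inv \<phi>) x = ?i g x" for x
    proof -
      have "Re (f (w * adj w)) = cmod (f (w * adj w))"
        using state_norm_nonneg[OF F_state[OF f(1)], of "adj w"]
        by (metis adj_adj norm_of_real abs_of_nonneg)
      moreover have "cmod (f (w * adj x)) = cmod (f (x * adj w))"
        using state_adj[OF F_state[OF f(1)], of "x * adj w"] by (simp add: adj_mult adj_adj)
      ultimately show ?thesis
        by (simp add: absf_def E_inv_def \<phi>_def bracket_real[OF f(1)] adj_adj f(2) norm_divide)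
    qed
    then have i: "?i g = absf (E_inv \<phi>)"
      by auto
    have "R_rng D F (?i g) = g"
      unfolding i using \<phi> f(2) by (simp add: R_rng_absf groupoid_E1_simps)
    moreover have "?i g \<in> R D F"
      unfolding i using \<phi>(1) by (simp add: R_def groupoid_E1_simps)
    moreover have "?i g w \<noteq> 0"
      using nz by (simp add: f(2) absf_def adj_adj)
    ultimately show ?thesis
      by (simp add: nonvanishing_def)
  qed
  have "continuous_on ?U (R_rng D F)"
    using topological_groupoid_R unfolding topological_groupoid_def
    by (auto simp: nonvanishing_def elim: continuous_on_subset)
  moreover have "continuous_on ?V ?i"
    by (intro continuous_on_coordinatewise_then_product continuous_on_divide continuous_on_real_sqrt
        continuous_on_eval) (auto simp: nonvanishing_def)
  ultimately show ?thesis
    using 1 2 by (intro homeomorphismI) auto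
qed

lemma etale_groupoid_R:
  "etale_groupoid (R D F) (absf ` F) (R_src D F) (R_rng D F) (R_mult D F) R_inv"
  unfolding etale_groupoid_def
proof (intro conjI ballI topological_groupoid_R)
  fix h assume "h \<in> R D F"
  then obtain w where w: "w \<in> N" "h w > 0"
    by (rule R_nonzero)
  let ?V = "absf ` F \<inter> nonvanishing (w * adj w)"
  note hom = homeomorphism_R_rng[OF w(1)]
  then have "R_rng D F ` nonvanishing w = ?V"
    by (simp add: homeomorphism_def)
  \<comment> \<open>The image is open in the whole groupoid because the unit space is itself a
    nonvanishing set.\<close>
  moreover have "openin (top_of_set (R D F)) ?V"
    unfolding units_R by (intro openin_Int openin_nonvanishing)
  moreover have "h \<in> nonvanishing w"
    using \<open>h \<in> R D F\<close> w(2) by (simp add: nonvanishing_def)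
  ultimately show "\<exists>U. openin (top_of_set (R D F)) U \<and> h \<in> U \<and>
      openin (top_of_set (R D F)) (R_rng D F ` U) \<and>
      (\<exists>g. homeomorphism U (R_rng D F ` U) (R_rng D F) g)"
    using hom openin_nonvanishing[of w] by (intro exI[of _ "nonvanishing w"]) auto
qed

lemma R_src_determines:
  assumes "h \<in> nonvanishing w" "w \<in> N"
  shows "h x = R_src D F h (adj w * x) / sqrt (R_src D F h (adj w * w))"
proof -
  have h: "h \<in> R D F" "h w \<noteq> 0"
    using assms(1) by (auto simp: nonvanishing_def)
  have "sqrt (h w * h w) = h w"
    using R_nonneg[OF h(1)] by simp
  then show ?thesis
    using R_eval(3)[OF h(1) assms(2) h(2)] h(2) by simp
qed

lemma open_bisection_nonvanishing:
  assumes "w \<in> N"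
  shows "open_bisection (R D F) (R_src D F) (R_rng D F) (nonvanishing w)"
  unfolding open_bisection_def
proof (intro conjI openin_nonvanishing)
  show "inj_on (R_src D F) (nonvanishing w)"
  proof (rule inj_onI, rule ext)
    fix g h x assume *: "g \<in> nonvanishing w" "h \<in> nonvanishing w" "R_src D F g = R_src D F h"
    show "g x = h x"
      unfolding R_src_determines[OF *(1) assms, of x] R_src_determines[OF *(2) assms, of x] *(3) ..
  qed
  show "inj_on (R_rng D F) (nonvanishing w)"
  proof (rule inj_onI)
    fix g h assume *: "g \<in> nonvanishing w" "h \<in> nonvanishing w" "R_rng D F g = R_rng D F h"
    note inverse = homeomorphism_apply1[OF homeomorphism_R_rng[OF assms]]
    show "g = h"
      by (rule trans[OF inverse[OF *(1), unfolded *(3), symmetric] inverse[OF *(2)]])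
  qed
qed

subsection \<open>The twist\<close>

text \<open>This is the lift \<open>[w, s(h)]\<close>, the one whose value at \<open>w\<close> is
  positive. The source state is recovered from its absolute value by \<open>unabs\<close>, so the
  formula uses \<open>h\<close> alone and is continuous in it.\<close>

definition section_at :: "'a \<Rightarrow> ('a \<Rightarrow> real) \<Rightarrow> 'a \<Rightarrow> complex" where
  "section_at w h x = unabs (R_src D F h) (adj w * x) / of_real (h w)"

lemma section_at_absf:
  assumes "\<phi> \<in> E1 D F" "w \<in> N" "\<phi> w \<noteq> 0"
  shows "section_at w (absf \<phi>) = (\<lambda>x. cnj (\<phi> w) / of_real (cmod (\<phi> w)) * \<phi> x)"
  by (simp add: section_at_def[abs_def] R_src_absf unabs_absf groupoid_E1_simps assms(1)
      E1_eval(3)[OF assms] mult.commute) (simp add: absf_def)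

lemma section_at_E1:
  assumes "h \<in> nonvanishing w" "w \<in> N"
  shows "section_at w h \<in> E1 D F" "absf (section_at w h) = h" "section_at w h w = of_real (h w)"
proof -
  obtain \<phi> where \<phi>: "\<phi> \<in> E1 D F" "h = absf \<phi>" "\<phi> w \<noteq> 0"
    using assms(1) by (auto simp: nonvanishing_def R_def absf_def)
  have z: "cmod (cnj (\<phi> w) / of_real (cmod (\<phi> w))) = 1"
    using \<phi>(3) by (simp add: norm_divide)
  note s = section_at_absf[OF \<phi>(1) assms(2) \<phi>(3)]
  show "section_at w h \<in> E1 D F"
    unfolding \<phi>(2) s by (rule E1_scale(1)[OF \<phi>(1) z])
  show "absf (section_at w h) = h"
    unfolding \<phi>(2) s by (rule absf_scale[OF z])
  have "cnj (\<phi> w) * \<phi> w = of_real (cmod (\<phi> w)) * of_real (cmod (\<phi> w))"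
    using complex_norm_square[of "\<phi> w"] by (simp add: power2_eq_square mult.commute)
  then show "section_at w h w = of_real (h w)"
    using \<phi>(3) unfolding \<phi>(2) s by (simp add: absf_def)
qed

lemma continuous_section_at:
  shows "continuous_on (nonvanishing w) (section_at w)"
proof -
  have "continuous_on (nonvanishing w) (R_src D F)"
    using topological_groupoid_R unfolding topological_groupoid_def
    by (auto simp: nonvanishing_def elim: continuous_on_subset)
  then have "continuous_on (nonvanishing w) (\<lambda>h. unabs (R_src D F h))"
    by (rule continuous_on_compose2[OF continuous_unabs[of UNIV]]) simp
  then have "continuous_on (nonvanishing w) (\<lambda>h. unabs (R_src D F h) x)" for x
    by (rule continuous_on_product_then_coordinatewise)
  then show ?thesis
    unfolding section_at_def[abs_def]
    by (intro continuous_on_coordinatewise_then_product continuous_on_divide continuous_on_of_real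
        continuous_on_eval) (auto simp: nonvanishing_def)
qed

text \<open>The forward map is multiplication of the section by \<open>z\<close>. Since the section
  is positive at \<open>w\<close>, the phase of \<open>\<phi> w\<close> gives \<open>z\<close>
  back.\<close>

lemma local_triviality:
  assumes w: "w \<in> N"
  shows "homeomorphism (circle \<times> nonvanishing w) {\<phi> \<in> E1 D F. absf \<phi> \<in> nonvanishing w}
    (\<lambda>(z, h). E_mult D F (iota (z, E_rng D F (section_at w h))) (section_at w h))
    (\<lambda>\<phi>. (\<phi> w / of_real (cmod (\<phi> w)), absf \<phi>))"
    (is "homeomorphism ?A ?B ?f ?k")
proof -
  have f: "?f (z, h) = (\<lambda>x. z * section_at w h x)" if "z \<in> circle" "h \<in> nonvanishing w" for z h
    using that E_mult_iota(1)[OF section_at_E1(1)[OF that(2) w], of z] by (simp add: circle_def)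
  have "continuous_on ?A (\<lambda>p x. fst p * section_at w (snd p) x)"
  proof (intro continuous_on_coordinatewise_then_product continuous_on_mult
      continuous_on_fst continuous_on_id)
    fix x
    have "continuous_on ?A (\<lambda>p. section_at w (snd p))"
      by (rule continuous_on_compose2[OF continuous_section_at]) (auto intro: continuous_on_snd continuous_on_id)
    then show "continuous_on ?A (\<lambda>p. section_at w (snd p) x)"
      by (rule continuous_on_product_then_coordinatewise)
  qed
  then have cf: "continuous_on ?A ?f"
    by (rule continuous_on_eq) (use f in auto)
  have ck: "continuous_on ?B ?k"
    by (intro continuous_on_Pair continuous_on_divide continuous_on_of_real continuous_on_norm
        continuous_on_eval continuous_absf) (auto simp: nonvanishing_def absf_def)
  have 1: "?f (z, h) \<in> ?B \<and> ?k (?f (z, h)) = (z, h)" if zh: "z \<in> circle" "h \<in> nonvanishing w" for z h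
  proof -
    note s = section_at_E1[OF zh(2) w]
    have z: "cmod z = 1"
      using zh(1) by (simp add: circle_def)
    have h: "h w > 0"
      using zh(2) R_nonneg[of h w] by (auto simp: nonvanishing_def less_le)
    show ?thesis
      unfolding f[OF zh]
      using E1_scale(1)[OF s(1) z] zh(2) z h by (simp add: absf_scale[OF z] s norm_mult)
  qed
  have 2: "?k \<phi> \<in> ?A \<and> ?f (?k \<phi>) = \<phi>" if \<phi>: "\<phi> \<in> ?B" for \<phi>
  proof -
    have p: "\<phi> \<in> E1 D F" "\<phi> w \<noteq> 0" "absf \<phi> \<in> nonvanishing w"
      using \<phi> by (auto simp: nonvanishing_def absf_def)
    have c: "\<phi> w / of_real (cmod (\<phi> w)) \<in> circle"
      using p(2) by (simp add: circle_def norm_divide)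
    have "\<phi> w / of_real (cmod (\<phi> w)) * (cnj (\<phi> w) / of_real (cmod (\<phi> w))) = 1"
      using p(2) complex_norm_square[of "\<phi> w"] by (simp add: power2_eq_square)
    then have "?f (?k \<phi>) = \<phi>"
      unfolding f[OF c p(3)] section_at_absf[OF p(1) w p(2)]
      by (simp only: mult.assoc[symmetric] mult_1_left)
    then show ?thesis
      using c p(3) by simp
  qed
  have A: "?f p \<in> ?B \<and> ?k (?f p) = p" if "p \<in> ?A" for p
  proof -
    have "fst p \<in> circle" "snd p \<in> nonvanishing w"
      using that by auto
    from 1[OF this] show ?thesis
      by (simp only: prod.collapse)
  qed
  show ?thesis
  proof (rule homeomorphismI[OF cf ck])
    show "?f ` ?A \<subseteq> ?B" "?k ` ?B \<subseteq> ?A"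
      using A 2 by (simp_all only: image_subset_iff) blast+
    show "?k (?f p) = p" if "p \<in> ?A" for p
      using A[OF that] by (rule conjunct2)
    show "?f (?k \<phi>) = \<phi>" if "\<phi> \<in> ?B" for \<phi>
      using 2[OF that] by (rule conjunct2)
  qed
qed

lemma iota_E1:
  assumes "f \<in> F" "z \<in> circle"
  shows "iota (z, f) \<in> E1 D F" "E_src D F (iota (z, f)) = f" "E_rng D F (iota (z, f)) = f"
  using E1_scale[of f z] assms by (simp_all add: iota_def circle_def groupoid_E1_simps)

section \<open>Assembly of the topological groupoids and the twist\<close>

lemma lch_groupoid_E1:
  "lch_groupoid (E1 D F) F (E_src D F) (E_rng D F) (E_mult D F) E_inv"
  by (simp add: lch_groupoid_def lc_groupoid_def topological_groupoid_E1 locally_compact_E1_R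
      Hausdorff_space_fun)

lemma lch_groupoid_R:
  "lch_groupoid (R D F) (absf ` F) (R_src D F) (R_rng D F) (R_mult D F) R_inv"
  by (simp add: lch_groupoid_def lc_groupoid_def topological_groupoid_R locally_compact_E1_R
      Hausdorff_space_fun)

lemma src_images: "E_src D F ` E1 D F = F" "R_src D F ` R D F = absf ` F"
proof -
  show E: "E_src D F ` E1 D F = F"
    using groupoid_E1_simps(1,2,4) by (metis image_eqI image_subsetI subsetI subset_antisym)
  have "R_src D F ` R D F = absf ` E_src D F ` E1 D F"
    by (auto simp: R_def image_image R_src_absf)
  then show "R_src D F ` R D F = absf ` F"
    by (simp only: E)
qed

lemma twist_E1_R:
  "twist (E1 D F) F (E_src D F) (E_rng D F) (E_mult D F) E_inv
     (R D F) (absf ` F) (R_src D F) (R_rng D F) (R_mult D F) R_inv iota absf"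
  unfolding twist_def
proof (intro conjI)
  show "lc_groupoid (E1 D F) F (E_src D F) (E_rng D F) (E_mult D F) E_inv"
    using lch_groupoid_E1 by (simp add: lch_groupoid_def)
  show "lc_groupoid (R D F) (absf ` F) (R_src D F) (R_rng D F) (R_mult D F) R_inv"
    using lch_groupoid_R by (simp add: lch_groupoid_def)
  show "etale_groupoid (R D F) (absf ` F) (R_src D F) (R_rng D F) (R_mult D F) R_inv"
    by (rule etale_groupoid_R)
  show "iota ` (circle \<times> F) \<subseteq> E1 D F"
    using iota_E1(1) by blast
  show iota: "continuous_on (circle \<times> F) iota" for F :: "('a \<Rightarrow> complex) set"
    unfolding iota_def[abs_def]
    by (intro continuous_on_coordinatewise_then_product continuous_on_mult continuous_on_fst
        continuous_on_id continuous_on_snd_eval)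
  show "\<forall>z1\<in>circle. \<forall>z2\<in>circle. \<forall>e\<in>F. E_src D F (iota (z1, e)) = E_rng D F (iota (z2, e)) \<and>
      E_mult D F (iota (z1, e)) (iota (z2, e)) = iota (z1 * z2, e)"
  proof (intro ballI conjI)
    fix z1 z2 e assume *: "z1 \<in> circle" "z2 \<in> circle" "e \<in> F"
    show "E_src D F (iota (z1, e)) = E_rng D F (iota (z2, e))"
      using * by (simp add: iota_E1)
    show "E_mult D F (iota (z1, e)) (iota (z2, e)) = iota (z1 * z2, e)"
      using E_mult_iota(1)[OF iota_E1(1)[OF *(3,2)], of z1] * iota_E1(3)[OF *(3,2)]
      by (simp add: circle_def) (simp add: iota_def mult.assoc)
  qed
  show "absf ` E1 D F \<subseteq> R D F" "absf ` E1 D F = R D F"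
    by (simp_all add: R_def)
  show "continuous_on (E1 D F) absf"
    by (rule continuous_absf)
  show "\<forall>x\<in>E1 D F. \<forall>y\<in>E1 D F. E_src D F x = E_rng D F y \<longrightarrow>
      R_src D F (absf x) = R_rng D F (absf y) \<and> absf (E_mult D F x y) = R_mult D F (absf x) (absf y)"
    by (simp add: R_composable R_mult_absf)
  show "inj_on iota (circle \<times> F)"
  proof (rule inj_onI, clarify)
    fix a f b g assume *: "a \<in> circle" "f \<in> F" "b \<in> circle" "g \<in> F" "iota (a, f) = iota (b, g)"
    \<comment> \<open>The source recovers the unit, and evaluation at \<open>1\<close> then recovers
      the phase.\<close>
    then have "f = g"
      using iota_E1(2) by metis
    moreover have "a = b"
      using fun_cong[OF *(5), of 1] is_state_simps(6)[OF F_state[OF *(2)]]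
        is_state_simps(6)[OF F_state[OF *(4)]] by (simp add: iota_def)
    ultimately show "a = b \<and> f = g"
      by simp
  qed
  show "{x \<in> E1 D F. absf x \<in> absf ` F} = iota ` (circle \<times> F)"
  proof (intro equalityI subsetI)
    fix \<phi> assume "\<phi> \<in> {x \<in> E1 D F. absf x \<in> absf ` F}"
    then obtain f where f: "\<phi> \<in> E1 D F" "f \<in> F" "absf \<phi> = absf f"
      by auto
    \<comment> \<open>An arrow whose absolute value is that of a unit differs from this unit only by
      a phase.\<close>
    obtain z where "cmod z = 1" "\<phi> = (\<lambda>x. z * f x)"
      using absf_eq[OF f(1) groupoid_E1_simps(1)[OF f(2)] f(3)] .
    then have "z \<in> circle" "\<phi> = iota (z, f)"
      by (simp_all add: circle_def iota_def)
    then show "\<phi> \<in> iota ` (circle \<times> F)"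
      using f(2) by blast
  next
    fix \<phi> assume "\<phi> \<in> iota ` (circle \<times> F)"
    then obtain z f where zf: "z \<in> circle" "f \<in> F" "\<phi> = iota (z, f)"
      by auto
    then have "absf \<phi> = absf f"
      using absf_scale[of z f] by (simp add: circle_def iota_def)
    then show "\<phi> \<in> {x \<in> E1 D F. absf x \<in> absf ` F}"
      using zf iota_E1(1) by auto
  qed
  show "\<exists>g. homeomorphism ({1} \<times> F) F iota g"
  proof
    have "continuous_on ({1} \<times> F) iota"
      by (rule continuous_on_subset[OF iota[of F]]) (auto simp: circle_def)
    then show "homeomorphism ({1} \<times> F) F iota (\<lambda>f. (1, f))"
      by (intro homeomorphismI continuous_on_Pair continuous_on_const continuous_on_id)
        (auto simp: iota_def)
  qed
  show "\<exists>g. homeomorphism F (absf ` F) absf g"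
    \<comment> \<open>Polarization provides the continuous inverse on units.\<close>
    by (intro exI[of _ unabs] homeomorphismI continuous_absf continuous_unabs) (auto simp: unabs_absf)
  show "\<forall>\<gamma>\<in>E1 D F. \<forall>z\<in>circle. E_mult D F (iota (z, E_rng D F \<gamma>)) \<gamma> = E_mult D F \<gamma> (iota (z, E_src D F \<gamma>))"
    by (simp add: E_mult_iota circle_def)
  show "\<forall>g\<in>R D F. \<exists>U j. open_bisection (R D F) (R_src D F) (R_rng D F) U \<and> g \<in> U \<and>
      continuous_on U j \<and> j ` U \<subseteq> E1 D F \<and> (\<forall>h\<in>U. absf (j h) = h) \<and>
      (\<exists>k. homeomorphism (circle \<times> U) {x \<in> E1 D F. absf x \<in> U}
        (\<lambda>(z, h). E_mult D F (iota (z, E_rng D F (j h))) (j h)) k)"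
  proof
    fix h assume h: "h \<in> R D F"
    then obtain w where w: "w \<in> N" "h w > 0"
      by (rule R_nonzero)
    show "\<exists>U j. open_bisection (R D F) (R_src D F) (R_rng D F) U \<and> h \<in> U \<and>
      continuous_on U j \<and> j ` U \<subseteq> E1 D F \<and> (\<forall>h\<in>U. absf (j h) = h) \<and>
      (\<exists>k. homeomorphism (circle \<times> U) {x \<in> E1 D F. absf x \<in> U}
        (\<lambda>(z, h). E_mult D F (iota (z, E_rng D F (j h))) (j h)) k)"
    proof (intro exI conjI ballI)
      show "open_bisection (R D F) (R_src D F) (R_rng D F) (nonvanishing w)"
        by (rule open_bisection_nonvanishing[OF w(1)])
      show "h \<in> nonvanishing w"
        using h w(2) by (simp add: nonvanishing_def)
      show "continuous_on (nonvanishing w) (section_at w)"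
        by (rule continuous_section_at)
      show "section_at w ` nonvanishing w \<subseteq> E1 D F"
        using section_at_E1(1)[OF _ w(1)] by blast
      show "absf (section_at w g) = g" if "g \<in> nonvanishing w" for g
        using that w(1) by (rule section_at_E1(2))
    qed (rule local_triviality[OF w(1)])
  qed
qed

end

theorem theorem7p9:
  fixes D :: "'a::cstar_algebra set" and F :: "('a \<Rightarrow> complex) set"
  assumes "abelian_cstar_subalgebra D"
    and "regular_inclusion D"
    and "covering_inclusion D"
    and "compatible_cover D F"
  shows "lch_groupoid (E1 D F) F (E_src D F) (E_rng D F) (E_mult D F) E_inv \<and>
         lch_groupoid (R D F) (absf ` F) (R_src D F) (R_rng D F) (R_mult D F) R_inv \<and>
         etale_groupoid (R D F) (absf ` F) (R_src D F) (R_rng D F) (R_mult D F) R_inv \<and>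
         E_src D F ` E1 D F = F \<and> R_src D F ` R D F = absf ` F \<and>
         twist (E1 D F) F (E_src D F) (E_rng D F) (E_mult D F) E_inv
               (R D F) (absf ` F) (R_src D F) (R_rng D F) (R_mult D F) R_inv
               iota absf \<and>
         Hausdorff_space (top_of_set (R D F))"
proof -
  interpret cover_inclusion D F
    using assms(1,4) by unfold_locales
  show ?thesis
    by (intro conjI lch_groupoid_E1 lch_groupoid_R etale_groupoid_R src_images twist_E1_R
        Hausdorff_space_fun)
qed

end
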